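(* Let $k\in\{1,2\}$, let $N\ge n>k$ be integers and $0\le b_1<\dots<b_n\le N-1$. Let $s_kw_0$ denote the permutation $n(n-1)\cdots(k+2)\,k\,(k+1)\,(k-1)\cdots 21$ (the reverse permutation with the values $k$ and $k+1$ interchanged). Let $A_k$ be the $n\times n$ matrix whose entry in row $i$ and column $j$ is $\binom{b_i+j-1}{j-1}$ if $1\le i\le n-k$ and $\binom{b_i+j-2}{j-2}$ if $n-k<i\le n$ (with $\binom{m}{-1}=0$). Then \[G_{s_kw_0}(b_1,\dots,b_n;N)=\binom{N}{k}\det A_k-G_{w_0}(b_1,\dots,b_n;N),\] where $w_0=n(n-1)\cdots 21$ and $G_{w_0}(b_1,\dots,b_n;N)=\prod_{1\le k'<l\le n}(b_l-b_{k'})\prod_{d=1}^{n-1}\frac1{d!}$.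
   Context: A discrete multiline queue (MLQ) of type $(1,\dots,1)$ on a ring of length $N$ consists of $n$ rows indexed $1,\dots,n$ from top to bottom; row $i$ contains $i$ boxes placed at distinct positions (columns) in $\{0,1,\dots,N-1\}$, the columns being arranged cyclically. Boxes are labelled row by row from top to bottom: the box in row $1$ gets label $1$. Once row $i$ is labelled, go through its boxes in an order in which boxes with smaller label come before boxes with larger label; for a box with label $k'$ in column $c$, find the first still-unlabelled box in row $i+1$ at column weakly to the right of $c$ (cyclically) and give it label $k'$. The one remaining unlabelled box of row $i+1$ gets label $i+1$. For a permutation $\pi$ of $[n]$ and $b_1<\dots<b_n$, $G_\pi(b_1,\dots,b_n;N)$ denotes the number of such MLQs whose bottom-row boxes are at positions $b_1,\dots,b_n$ with the box at $b_i$ labelled $\pi_i$. *)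

theory Defs
  imports
    "HOL-Library.FuncSet"
    "HOL-Combinatorics.Transposition"
    "Jordan_Normal_Form.Determinant"
begin

definition mlqs :: "nat \<Rightarrow> nat \<Rightarrow> (nat \<Rightarrow> nat set) set" where
  "mlqs n N = (\<Pi>\<^sub>E i\<in>{1..n}. {S. S \<subseteq> {0..<N} \<and> card S = i})"

text \<open>The box of \<open>U\<close> met first when moving weakly to the right from column \<open>c\<close> on the ring
  of length \<open>N\<close>; for \<open>c, d < N\<close> the number of steps from \<open>c\<close> to \<open>d\<close> is \<open>(d + N - c) mod N\<close>.\<close>

definition first_right :: "nat \<Rightarrow> nat \<Rightarrow> nat set \<Rightarrow> nat" where
  "first_right N c U = (ARG_MIN (\<lambda>d. (d + N - c) mod N) d. d \<in> U)"

text \<open>In an MLQ of type \<open>(1, \<dots>, 1)\<close> the labels of row \<open>i\<close> are \<open>1, \<dots>, i\<close>, each used once. A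
  labelled row is therefore encoded as the list of its columns ordered by label: entry number
  \<open>l - 1\<close> is the column of the box labelled \<open>l\<close>. The function \<open>label_row\<close> takes the labelled
  row above and the set of still unlabelled boxes of the current row; its last entry is the one
  remaining box, which gets the new label.\<close>

fun label_row :: "nat \<Rightarrow> nat list \<Rightarrow> nat set \<Rightarrow> nat list" where
  "label_row N [] U = [the_elem U]"
| "label_row N (c # cs) U =
     (let d = first_right N c U in d # label_row N cs (U - {d}))"

fun labelled_row :: "nat \<Rightarrow> (nat \<Rightarrow> nat set) \<Rightarrow> nat \<Rightarrow> nat list" where
  "labelled_row N Q 0 = []"
| "labelled_row N Q (Suc i) = label_row N (labelled_row N Q i) (Q (Suc i))"

definition box_col :: "nat \<Rightarrow> (nat \<Rightarrow> nat set) \<Rightarrow> nat \<Rightarrow> nat \<Rightarrow> nat" where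
  "box_col N Q i l = labelled_row N Q i ! (l - 1)"

text \<open>Permutations of \<open>{1..n}\<close> and the sequence \<open>b\<^sub>1, \<dots>, b\<^sub>n\<close> are functions on \<^typ>\<open>nat\<close> of which
  only the values at \<open>1, \<dots>, n\<close> matter.\<close>

definition G :: "nat \<Rightarrow> (nat \<Rightarrow> nat) \<Rightarrow> (nat \<Rightarrow> nat) \<Rightarrow> nat \<Rightarrow> nat" where
  "G n \<pi> b N = card {Q \<in> mlqs n N. Q n = b ` {1..n} \<and> (\<forall>i\<in>{1..n}. box_col N Q n (\<pi> i) = b i)}"

definition w0 :: "nat \<Rightarrow> nat \<Rightarrow> nat" where
  "w0 n i = n + 1 - i"

definition skw0 :: "nat \<Rightarrow> nat \<Rightarrow> nat \<Rightarrow> nat" where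
  "skw0 n k = Transposition.transpose k (k + 1) \<circ> w0 n"

definition A_entry :: "nat \<Rightarrow> nat \<Rightarrow> (nat \<Rightarrow> nat) \<Rightarrow> nat \<Rightarrow> nat \<Rightarrow> nat" where
  "A_entry n k b i j =
     (if i \<le> n - k then (b i + j - 1) choose (j - 1)
      else if j = 1 then 0
      else (b i + j - 2) choose (j - 2))"

text \<open>\<^const>\<open>mat\<close> indexes rows and columns from \<open>0\<close>, the entries above are indexed from \<open>1\<close>.\<close>

definition A_mat :: "nat \<Rightarrow> nat \<Rightarrow> (nat \<Rightarrow> nat) \<Rightarrow> rat mat" where
  "A_mat n k b = mat n n (\<lambda>(i, j). of_nat (A_entry n k b (i + 1) (j + 1)))"

end

theory Submission
  imports Defs "HOL-Computational_Algebra.Polynomial"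
begin

text \<open>Both sides satisfy the same recursion on the number of rows. The row above a row labelled
  \<open>w\<^sub>0\<close> is again labelled \<open>w\<^sub>0\<close> and interlaces it, \<open>b\<^sub>i < c\<^sub>i \<le> b\<^sub>i\<^sub>+\<^sub>1\<close>, and summing the
  determinant of the \<open>binom(c\<^sub>i + j - 1, j - 1)\<close> over these \<open>c\<close> row by row gives the next one. For
  \<open>s\<^sub>kw\<^sub>0\<close> one counts \<open>G(w\<^sub>0) + G(s\<^sub>kw\<^sub>0)\<close>: forgetting which of two adjacent boxes carries \<open>k\<close> and which
  \<open>k + 1\<close> leaves the rows \<open>c\<close> that interlace \<open>b\<close> except that the right box \<open>y\<close> of the pair only
  satisfies \<open>x < y\<close> with respect to the left box \<open>x\<close>. In \<open>A\<^sub>k\<close> the last \<open>k\<close> rows are backward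
  differences of the row function \<open>f\<close>, so summing over \<open>y \<in> {x<..v}\<close> turns the row of \<open>y\<close> into
  \<open>f v - f x\<close>, and \<open>f x\<close> cancels against the row of \<open>x\<close>. Wrapping around the ring matters only in the
  base case \<open>n = k + 1\<close>, which is counted directly for \<open>k = 1, 2\<close> and yields \<open>binom(N, k)\<close>.\<close>

subsection \<open>Determinants\<close>

lemma det_mat_sum_PiE:
  fixes g :: "nat \<Rightarrow> 'b \<Rightarrow> nat \<Rightarrow> 'a::comm_ring_1"
  assumes "\<And>i. i < n \<Longrightarrow> finite (T i)"
  shows "(\<Sum>c\<in>PiE {..<n} T. det (mat n n (\<lambda>(i, j). g i (c i) j))) =
    det (mat n n (\<lambda>(i, j). \<Sum>t\<in>T i. g i t j))"
proof -
  \<comment> \<open>In the Leibniz formula each product takes one factor from every row, so it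
    distributes over independent choices of the \<open>c i\<close>.\<close>
  have det_eq: "det (mat n n (\<lambda>(i, j). h i j)) =
      (\<Sum>p | p permutes {0..<n}. signof p * (\<Prod>i<n. h i (p i)))"
    for h :: "nat \<Rightarrow> nat \<Rightarrow> 'a"
    by (subst det_def'[of _ n])
      (auto intro!: sum.cong arg_cong[where f = "(*) _"] prod.cong
        simp: lessThan_atLeast0 permutes_in_image[where S = "{0..<n}", simplified])
  have "(\<Sum>c\<in>PiE {..<n} T. det (mat n n (\<lambda>(i, j). g i (c i) j))) =
      (\<Sum>p | p permutes {0..<n}. signof p * (\<Sum>c\<in>PiE {..<n} T. \<Prod>i<n. g i (c i) (p i)))"
    unfolding det_eq by (subst sum.swap) (simp add: sum_distrib_left)
  also have "\<dots> = (\<Sum>p | p permutes {0..<n}. signof p * (\<Prod>i<n. \<Sum>t\<in>T i. g i t (p i)))"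
    using assms by (intro sum.cong refl arg_cong[where f = "(*) _"] prod_sum_PiE[symmetric]) auto
  finally show ?thesis
    by (simp only: det_eq)
qed

text \<open>Laplace expansion along row \<open>a\<close> is linear in that row, since its cofactors
  do not see the row.\<close>

lemma det_mat_sum_row:
  fixes h :: "'b \<Rightarrow> nat \<Rightarrow> 'a::comm_ring_1"
  assumes "finite X" "a < n"
  shows "(\<Sum>x\<in>X. det (mat n n (\<lambda>(i, j). if i = a then h x j else r i j))) =
    det (mat n n (\<lambda>(i, j). if i = a then \<Sum>x\<in>X. h x j else r i j))"
proof -
  \<comment> \<open>Row \<open>a\<close> is replaced by 0 inside the cofactors, which makes it
    visible that they are the same for every \<open>v\<close>.\<close>
  have laplace: "det (mat n n (\<lambda>(i, j). if i = a then v j else r i j)) =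
     (\<Sum>j<n. v j * cofactor (mat n n (\<lambda>(i, j). if i = a then 0 else r i j)) a j)" for v
  proof -
    have "mat_delete (mat n n (\<lambda>(i, j). if i = a then v j else r i j)) a j =
          mat_delete (mat n n (\<lambda>(i, j). if i = a then 0 else r i j)) a j" for j
      by (rule eq_matI) (auto simp: mat_delete_def)
    then show ?thesis
      using \<open>a < n\<close> by (subst laplace_expansion_row[of _ n a]) (auto simp: cofactor_def)
  qed
  show ?thesis
    unfolding laplace by (subst sum.swap) (simp add: sum_distrib_right)
qed

text \<open>Subtracting \<open>e i\<close> times row \<open>i\<close> from row \<open>i + 1\<close> clears the first column below the top entry.\<close>
lemma det_mat_clear_first_column:
  fixes R :: "nat \<Rightarrow> nat \<Rightarrow> 'a::comm_ring_1"
  assumes top: "R 0 0 = 1" and below: "\<And>i. i < n \<Longrightarrow> R (Suc i) 0 = e i * R i 0"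
  shows "det (mat (Suc n) (Suc n) (\<lambda>(i, j). R i j)) =
    det (mat n n (\<lambda>(i, j). R (Suc i) (Suc j) - e i * R i (Suc j)))"
proof -
  \<comment> \<open>\<open>L\<close> is unit lower bidiagonal. Multiplying by it performs all
    subtractions at once, each with the original row above and not an already modified one.\<close>
  define L where "L = mat (Suc n) (Suc n)
    (\<lambda>(i, j). if j = i then 1 else if i = Suc j then - e j else (0 :: 'a))"
  define A where "A = mat (Suc n) (Suc n) (\<lambda>(i, j). R i j)"
  define M where "M = mat (Suc n) (Suc n)
    (\<lambda>(i, j). if i = 0 then R 0 j else R i j - e (i - 1) * R (i - 1) j)"
  have carrier: "L \<in> carrier_mat (Suc n) (Suc n)" "A \<in> carrier_mat (Suc n) (Suc n)"
    "M \<in> carrier_mat (Suc n) (Suc n)"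
    by (auto simp: L_def A_def M_def)
  have "L * A = M"
  proof (rule eq_matI)
    fix i j assume "i < dim_row M" "j < dim_col M"
    then have i: "i < Suc n" and j: "j < Suc n" by (auto simp: M_def)
    have "(L * A) $$ (i, j) = (\<Sum>l<Suc n. L $$ (i, l) * R l j)"
      using i j by (auto simp: L_def A_def scalar_prod_def lessThan_atLeast0 intro!: sum.cong)
    also have "\<dots> = (\<Sum>l<Suc n. (if l = i then R i j else 0) +
        (if i \<noteq> 0 \<and> l = i - 1 then - e (i - 1) * R (i - 1) j else 0))"
      using i by (intro sum.cong) (auto simp: L_def)
    also have "\<dots> = M $$ (i, j)"
      using i j by (cases i) (auto simp: M_def sum.distrib)
    finally show "(L * A) $$ (i, j) = M $$ (i, j)" .
  qed (auto simp: L_def A_def M_def)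
  moreover have "det L = 1"
    by (subst det_lower_triangular[OF _ carrier(1)])
      (auto simp: L_def prod_list_diag_prod)
  ultimately have "det A = det M"
    using det_mult[OF carrier(1,2)] by simp
  also have "det M = (\<Sum>i<Suc n. M $$ (i, 0) * cofactor M i 0)"
    by (rule laplace_expansion_column[OF carrier(3)]) simp
  also have "\<dots> = (\<Sum>i<Suc n. if i = 0 then cofactor M 0 0 else 0)"
    using top below by (intro sum.cong) (auto simp: M_def gr0_conv_Suc)
  also have "\<dots> = det (mat_delete M 0 0)"
    by (simp add: cofactor_def)
  also have "mat_delete M 0 0 = mat n n (\<lambda>(i, j). R (Suc i) (Suc j) - e i * R i (Suc j))"
    by (rule eq_matI) (auto simp: mat_delete_def M_def)
  finally show ?thesis
    by (simp add: A_def)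
qed

section \<open>Binomial determinants and sums over interlacing rows\<close>

definition binom_row :: "nat \<Rightarrow> nat \<Rightarrow> nat \<Rightarrow> nat \<Rightarrow> rat" where
  "binom_row m i x j = (if i < m then of_nat ((x + j) choose j)
     else if j = 0 then 0 else of_nat ((x + j - 1) choose (j - 1)))"

text \<open>With indices from 0 and \<open>m = n - k\<close> this is the determinant of the matrix
  A_k. By Pascal's rule the rows from \<open>m\<close> on are the backward differences in
  \<open>x\<close> of the row function used before \<open>m\<close>; in column 0 the difference of
  the constant 1 is 0.\<close>

definition binom_det :: "nat \<Rightarrow> nat \<Rightarrow> (nat \<Rightarrow> nat) \<Rightarrow> rat" where
  "binom_det n m b = det (mat n n (\<lambda>(i, j). binom_row m i (b i) j))"

text \<open>Pascal's rule, telescoped. Summation moves column \<open>j\<close> to column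
  \<open>Suc j\<close>, which leaves room for the extra column of the larger determinant.\<close>

lemma sum_choose_interval:
  assumes "a \<le> b"
  shows "(\<Sum>t\<in>{a<..b}. of_nat ((t + j) choose j) :: rat) =
    of_nat ((b + Suc j) choose Suc j) - of_nat ((a + Suc j) choose Suc j)"
  using assms
proof (induction b rule: dec_induct)
  case (step b)
  then have "{a<..Suc b} = insert (Suc b) {a<..b}" by auto
  with step show ?case by simp
qed simp

text \<open>A row depends on \<open>i\<close> and \<open>m\<close> only through the test
  \<open>i < m\<close>. The second pair \<open>i'\<close>, \<open>m'\<close> is left free because
  the recursion changes both the row index and the threshold.\<close>

lemma sum_binom_row_upper:
  "a \<le> b \<Longrightarrow> i < m \<Longrightarrow> i' < m' \<Longrightarrow>
   (\<Sum>t\<in>{a<..b}. binom_row m i t j) = binom_row m' i' b (Suc j) - binom_row m' i' a (Suc j)"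
  using sum_choose_interval[of a b j] by (simp add: binom_row_def)

lemma sum_binom_row_lower:
  "a \<le> b \<Longrightarrow> \<not> i < m \<Longrightarrow> \<not> i' < m' \<Longrightarrow>
   (\<Sum>t\<in>{a<..b}. binom_row m i t j) = binom_row m' i' b (Suc j) - binom_row m' i' a (Suc j)"
  using sum_choose_interval[of a b "j - 1"] by (cases j) (simp_all add: binom_row_def)

text \<open>The ranges of the \<open>c i\<close> are independent, so every row can be summed
  separately. The result consists of differences of consecutive rows of the larger matrix, which is
  what clearing its first column of ones produces.\<close>

lemma binom_det_interlace:
  assumes "\<And>i. i < n \<Longrightarrow> b i \<le> b (Suc i)"
  shows "binom_det (Suc n) (Suc n) b =
    (\<Sum>c\<in>PiE {..<n} (\<lambda>i. {b i<..b (Suc i)}). binom_det n n c)"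
proof -
  have "(\<Sum>c\<in>PiE {..<n} (\<lambda>i. {b i<..b (Suc i)}). binom_det n n c) =
      det (mat n n (\<lambda>(i, j). \<Sum>t\<in>{b i<..b (Suc i)}. binom_row n i t j))"
    unfolding binom_det_def by (rule det_mat_sum_PiE) simp
  also have "mat n n (\<lambda>(i, j). \<Sum>t\<in>{b i<..b (Suc i)}. binom_row n i t j) =
      mat n n (\<lambda>(i, j). binom_row (Suc n) (Suc i) (b (Suc i)) (Suc j) -
        1 * binom_row (Suc n) i (b i) (Suc j))"
    using assms by (intro eq_matI)
      (auto simp: binom_row_def sum_choose_interval simp del: binomial_Suc_Suc)
  also have "det \<dots> = binom_det (Suc n) (Suc n) b"
    unfolding binom_det_def
    by (rule det_mat_clear_first_column[symmetric, where e = "\<lambda>_. 1"]) (auto simp: binom_row_def)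
  finally show ?thesis by simp
qed

text \<open>The entries at \<open>a\<close> and \<open>Suc a\<close> are the pair of boxes that may
  exchange labels. The true lower bound of \<open>c (Suc a)\<close> is \<open>c a\<close>; it is
  split off as a separate condition so that the ranges in \<open>PiE\<close> do not depend on
  \<open>c\<close>.\<close>

definition loose_interlacings :: "nat \<Rightarrow> nat \<Rightarrow> (nat \<Rightarrow> nat) \<Rightarrow> (nat \<Rightarrow> nat) set" where
  "loose_interlacings n a b = {c \<in> PiE {..<n}
     (\<lambda>i. if i = Suc a then {b a<..b (Suc (Suc a))} else {b i<..b (Suc i)}). c a < c (Suc a)}"

lemma finite_loose_interlacings: "finite (loose_interlacings n a b)"
  unfolding loose_interlacings_def
  by (rule finite_subset[of _ "PiE {..<n}
     (\<lambda>i. if i = Suc a then {b a<..b (Suc (Suc a))} else {b i<..b (Suc i)})"])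
    (auto intro!: finite_PiE)

text \<open>Once \<open>x = c a\<close> is fixed, the ranges become independent again and
  multilinearity applies; the sum over \<open>x\<close> is then linearity in the single row
  \<open>a\<close>.\<close>

lemma binom_det_loose_interlace:
  assumes mono: "\<And>i. i < n \<Longrightarrow> b i \<le> b (Suc i)" and a: "Suc a < n"
  shows "binom_det (Suc n) (Suc (Suc a)) b =
    (\<Sum>c\<in>loose_interlacings n a b. binom_det n (Suc a) c)"
proof -
  define T where "T x i = (if i = a then {x} else if i = Suc a then {x<..b (Suc (Suc a))}
    else {b i<..b (Suc i)})" for x i
  \<comment> \<open>These are the rows other than \<open>a\<close> after the row operation below.
    They no longer mention \<open>x\<close>, as linearity in row \<open>a\<close> requires.\<close>
  define r where "r i j = (if i = Suc a then of_nat ((b (Suc (Suc a)) + j) choose j)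
    else \<Sum>t\<in>{b i<..b (Suc i)}. binom_row (Suc a) i t j)" for i j
  let ?f = "\<lambda>x j. of_nat ((x + j) choose j) :: rat"
  have le: "b (Suc a) \<le> b (Suc (Suc a))" "b a \<le> b (Suc a)"
    using mono a by auto
  have fiber: "{c \<in> loose_interlacings n a b. c a = x} = PiE {..<n} (T x)"
    if x: "x \<in> {b a<..b (Suc a)}" for x
  proof (intro equalityI subsetI)
    fix c assume "c \<in> {c \<in> loose_interlacings n a b. c a = x}"
    then show "c \<in> PiE {..<n} (T x)"
      using a by (force simp: loose_interlacings_def T_def PiE_iff split: if_splits)
  next
    fix c assume c: "c \<in> PiE {..<n} (T x)"
    then have "c a \<in> T x a" "c (Suc a) \<in> T x (Suc a)"
      using a by (auto simp: PiE_iff)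
    then show "c \<in> {c \<in> loose_interlacings n a b. c a = x}"
      using c x by (force simp: loose_interlacings_def T_def PiE_iff split: if_splits)
  qed
  have inner: "(\<Sum>c\<in>PiE {..<n} (T x). binom_det n (Suc a) c) =
      det (mat n n (\<lambda>(i, j). if i = a then ?f x j else r i j))"
    if x: "x \<in> {b a<..b (Suc a)}" for x
  proof -
    let ?M = "mat n n (\<lambda>(i, j). \<Sum>t\<in>T x i. binom_row (Suc a) i t j)"
    have xr: "(\<Sum>t\<in>{x<..b (Suc (Suc a))}. binom_row (Suc a) (Suc a) t j) =
        ?f (b (Suc (Suc a))) j - ?f x j" for j
      using x le by (subst sum_binom_row_lower[where m' = 0 and i' = 0]) (auto simp: binom_row_def)
    have "(\<Sum>c\<in>PiE {..<n} (T x). binom_det n (Suc a) c) = det ?M"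
      unfolding binom_det_def by (rule det_mat_sum_PiE) (simp add: T_def)
    \<comment> \<open>Row \<open>Suc a\<close> is \<open>?f\<close> at the right end minus
      \<open>?f x\<close>, and row \<open>a\<close> is \<open>?f x\<close>; adding the latter
      removes \<open>x\<close> from row \<open>Suc a\<close>.\<close>
    also have "\<dots> = det (addrow 1 (Suc a) a ?M)"
      using a by (intro det_addrow[symmetric, where n = n]) auto
    also have "addrow 1 (Suc a) a ?M = mat n n (\<lambda>(i, j). if i = a then ?f x j else r i j)"
      using a by (intro eq_matI) (auto simp: T_def r_def xr, simp_all add: binom_row_def)
    finally show ?thesis .
  qed
  have "(\<Sum>c\<in>loose_interlacings n a b. binom_det n (Suc a) c) =
      (\<Sum>x\<in>{b a<..b (Suc a)}. \<Sum>c\<in>{c \<in> loose_interlacings n a b. c a = x}. binom_det n (Suc a) c)"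
    using a by (intro sum.group[symmetric] finite_loose_interlacings)
      (auto simp: loose_interlacings_def PiE_iff split: if_splits)
  also have "\<dots> = (\<Sum>x\<in>{b a<..b (Suc a)}.
      det (mat n n (\<lambda>(i, j). if i = a then ?f x j else r i j)))"
    by (intro sum.cong refl) (simp only: fiber inner)
  also have "\<dots> = det (mat n n (\<lambda>(i, j). if i = a then \<Sum>x\<in>{b a<..b (Suc a)}. ?f x j else r i j))"
    using a by (intro det_mat_sum_row) auto
  \<comment> \<open>The multiplier 0 at \<open>Suc a\<close> marks the change of row type: in the
    larger matrix row \<open>Suc a\<close> starts with 1 and row \<open>Suc (Suc a)\<close> already
    starts with 0, so nothing has to be subtracted there.\<close>
  also have "mat n n (\<lambda>(i, j). if i = a then \<Sum>x\<in>{b a<..b (Suc a)}. ?f x j else r i j) =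
      mat n n (\<lambda>(i, j). binom_row (Suc (Suc a)) (Suc i) (b (Suc i)) (Suc j) -
        (if i = Suc a then 0 else 1) * binom_row (Suc (Suc a)) i (b i) (Suc j))"
    (is "?L = ?R")
  proof (rule eq_matI)
    fix i j assume "i < dim_row ?R" "j < dim_col ?R"
    then have ij: "i < n" "j < n" by auto
    consider "i < a" | "i = a" | "i = Suc a" | "i > Suc a" by linarith
    then show "?L $$ (i, j) = ?R $$ (i, j)"
    proof cases
      case 1
      then show ?thesis using ij mono[of i]
        by (simp add: r_def sum_binom_row_upper[where m' = "Suc (Suc a)" and i' = i])
          (simp add: binom_row_def)
    next
      case 2
      then show ?thesis using ij mono[of i]
        by (simp add: sum_choose_interval) (simp add: binom_row_def)
    next
      case 3
      then show ?thesis using ij by (simp add: r_def binom_row_def)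
    next
      case 4
      then show ?thesis using ij mono[of i]
        by (simp add: r_def sum_binom_row_lower[where m' = "Suc (Suc a)" and i' = i])
          (simp add: binom_row_def)
    qed
  qed auto
  also have "det \<dots> = binom_det (Suc n) (Suc (Suc a)) b"
    unfolding binom_det_def
    by (rule det_mat_clear_first_column[symmetric,
          where e = "\<lambda>i. if i = Suc a then 0 else 1"]) (auto simp: binom_row_def)
  finally show ?thesis by simp
qed

text \<open>This and \<open>binom_det_3\<close> are the determinants at \<open>n = k + 1\<close>.
  Only the top row is not a difference row, so the first column is already cleared and the
  multiplier is 0.\<close>

lemma binom_det_2: "binom_det 2 1 b = 1"
proof -
  have "binom_det (Suc 1) 1 b = det (mat 1 1 (\<lambda>(i, j). binom_row 1 (Suc i) (b (Suc i)) (Suc j)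
      - 0 * binom_row 1 i (b i) (Suc j)))"
    unfolding binom_det_def
    by (rule det_mat_clear_first_column[where e = "\<lambda>_. 0"]) (auto simp: binom_row_def)
  then show ?thesis
    by (simp add: det_single binom_row_def numeral_2_eq_2)
qed

lemma binom_det_3: "binom_det 3 1 b = of_nat (b 2) - of_nat (b 1)"
proof -
  have "binom_det (Suc 2) 1 b = det (mat 2 2 (\<lambda>(i, j). binom_row 1 (Suc i) (b (Suc i)) (Suc j)
      - 0 * binom_row 1 i (b i) (Suc j)))"
    unfolding binom_det_def
    by (rule det_mat_clear_first_column[where e = "\<lambda>_. 0"]) (auto simp: binom_row_def)
  also have "\<dots> = det (mat (Suc 1) (Suc 1) (\<lambda>(i, j). of_nat ((b (Suc i) + j) choose j)))"
    by (intro arg_cong[where f = det] eq_matI) (auto simp: binom_row_def)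
  also have "\<dots> = det (mat 1 1 (\<lambda>(i, j). of_nat ((b (Suc (Suc i)) + Suc j) choose Suc j)
      - 1 * of_nat ((b (Suc i) + Suc j) choose Suc j)))"
    by (rule det_mat_clear_first_column[where e = "\<lambda>_. 1"]) auto
  finally show ?thesis
    by (simp add: det_single numeral_2_eq_2 numeral_3_eq_3)
qed

section \<open>Vandermonde determinants with polynomial columns\<close>

lemma newton_basis_expansion:
  fixes q :: "'a::comm_ring_1 poly"
  assumes "degree q \<le> d"
  shows "\<exists>\<alpha>. \<alpha> d = coeff q d \<and>
    (\<forall>y. poly q y = (\<Sum>m\<le>d. \<alpha> m * (\<Prod>s<m. y - x s)))"
  using assms
proof (induction d arbitrary: q)
  case 0
  then obtain c where "q = [:c:]"
    using degree_eq_zeroE by blast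
  then show ?case
    by (intro exI[of _ "\<lambda>_. c"]) simp
next
  case (Suc d)
  define p where "p = (\<Prod>s<Suc d. [:- x s, 1:])"
  have p: "poly p y = (\<Prod>s<Suc d. y - x s)" for y
    by (simp add: p_def poly_prod algebra_simps)
  have deg: "degree (\<Prod>s<n. [:- x s, 1:]) \<le> n \<and> coeff (\<Prod>s<n. [:- x s, 1:]) n = 1" for n
  proof (induction n)
    case (Suc n)
    then have "degree ((\<Prod>s<n. [:- x s, 1:]) * [:- x n, 1:]) \<le> n + 1"
      by (intro order.trans[OF degree_mult_le] add_mono) auto
    moreover have "coeff ((\<Prod>s<n. [:- x s, 1:]) * [:- x n, 1:]) (Suc n) = 1"
      using Suc by (simp add: mult.commute[of _ "[:- x n, 1:]"] coeff_eq_0)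
    ultimately show ?case by simp
  qed simp
  from deg[of "Suc d"] have deg_p: "degree p \<le> Suc d" "coeff p (Suc d) = 1"
    unfolding p_def by blast+
  let ?q = "q - smult (coeff q (Suc d)) p"
  \<comment> \<open>The Newton product \<open>p\<close> is monic of degree \<open>Suc d\<close>, so
    subtracting the right multiple kills the top coefficient without any division.\<close>
  have "degree ?q \<le> d"
  proof (rule degree_le, intro allI impI)
    fix i assume "d < i"
    then consider "i = Suc d" | "i > Suc d" by linarith
    then show "coeff ?q i = 0"
      using deg_p Suc.prems by cases (auto simp: coeff_eq_0)
  qed
  from Suc.IH[OF this] obtain \<alpha> where
    \<alpha>: "\<And>y. poly ?q y = (\<Sum>m\<le>d. \<alpha> m * (\<Prod>s<m. y - x s))" by blast
  have "poly q y = (\<Sum>m\<le>Suc d. (\<alpha>(Suc d := coeff q (Suc d))) m * (\<Prod>s<m. y - x s))" for y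
  proof -
    have "poly q y = poly ?q y + coeff q (Suc d) * poly p y" by simp
    also have "\<dots> = (\<Sum>m\<le>d. \<alpha> m * (\<Prod>s<m. y - x s)) + coeff q (Suc d) * (\<Prod>s<Suc d. y - x s)"
      unfolding \<alpha> p ..
    finally show ?thesis by simp
  qed
  then show ?case
    by (intro exI[of _ "\<alpha>(Suc d := coeff q (Suc d))"]) simp
qed

text \<open>Expanding the columns in the Newton basis at the nodes \<open>x s\<close> factors the
  matrix as lower triangular times upper triangular: the product up to \<open>m\<close> vanishes at
  node \<open>i\<close> when \<open>i < m\<close>, and column \<open>j\<close> needs only basis
  elements up to \<open>j\<close>.\<close>

lemma det_polynomial_vandermonde:
  fixes q :: "nat \<Rightarrow> 'a::comm_ring_1 poly"
  assumes "\<And>j. j < n \<Longrightarrow> degree (q j) \<le> j"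
  shows "det (mat n n (\<lambda>(i, j). poly (q j) (x i))) =
    (\<Prod>l<n. \<Prod>k<l. x l - x k) * (\<Prod>j<n. coeff (q j) j)"
proof -
  have "\<exists>\<alpha>. \<forall>j<n. \<alpha> j j = coeff (q j) j \<and>
      (\<forall>y. poly (q j) y = (\<Sum>m\<le>j. \<alpha> j m * (\<Prod>s<m. y - x s)))"
    using newton_basis_expansion[OF assms, of _ x] by metis
  then obtain \<alpha> where \<alpha>: "\<And>j. j < n \<Longrightarrow> \<alpha> j j = coeff (q j) j"
    "\<And>j y. j < n \<Longrightarrow> poly (q j) y = (\<Sum>m\<le>j. \<alpha> j m * (\<Prod>s<m. y - x s))"
    by metis
  define A where "A = mat n n (\<lambda>(i, m). \<Prod>s<m. x i - x s)"
  define B where "B = mat n n (\<lambda>(m, j). if m \<le> j then \<alpha> j m else 0)"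
  have carrier: "A \<in> carrier_mat n n" "B \<in> carrier_mat n n"
    by (auto simp: A_def B_def)
  have "mat n n (\<lambda>(i, j). poly (q j) (x i)) = A * B"
  proof (rule eq_matI)
    fix i j assume "i < dim_row (A * B)" "j < dim_col (A * B)"
    then have ij: "i < n" "j < n" by (auto simp: A_def B_def)
    have "(A * B) $$ (i, j) = (\<Sum>m<n. if m \<le> j then \<alpha> j m * (\<Prod>s<m. x i - x s) else 0)"
      using ij by (auto simp: A_def B_def scalar_prod_def lessThan_atLeast0 intro!: sum.cong)
    also have "\<dots> = (\<Sum>m\<le>j. \<alpha> j m * (\<Prod>s<m. x i - x s))"
      using ij by (intro sum.mono_neutral_cong_right) auto
    finally show "mat n n (\<lambda>(i, j). poly (q j) (x i)) $$ (i, j) = (A * B) $$ (i, j)"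
      using ij \<alpha> by simp
  qed (auto simp: A_def B_def)
  moreover have "det A = (\<Prod>l<n. \<Prod>k<l. x l - x k)"
    by (subst det_lower_triangular[OF _ carrier(1)])
      (auto simp: A_def prod_list_diag_prod intro!: prod_zero simp flip: lessThan_atLeast0)
  moreover have "det B = (\<Prod>j<n. coeff (q j) j)"
    using \<alpha>(1) by (subst det_upper_triangular[OF _ carrier(2)])
      (auto simp: B_def prod_list_diag_prod lessThan_atLeast0)
  ultimately show ?thesis
    using det_mult[OF carrier] by simp
qed

text \<open>As a polynomial in \<open>x\<close>, \<open>(x + j) choose j\<close> has degree
  \<open>j\<close> and leading coefficient \<open>1 / fact j\<close>.\<close>

lemma binom_det_vandermonde:
  "binom_det n n b = (\<Prod>l<n. \<Prod>k<l. of_nat (b l) - of_nat (b k)) * (\<Prod>j<n. 1 / fact j)"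
proof -
  define q :: "nat \<Rightarrow> rat poly" where
    "q j = smult (1 / fact j) (\<Prod>s<j. [:of_nat (Suc s), 1:])" for j
  have q: "degree (q j) \<le> j" "coeff (q j) j = 1 / fact j" for j
  proof -
    have "degree (\<Prod>s<j. [:of_nat (Suc s) :: rat, 1:]) = j"
      by (subst degree_prod_sum_eq) auto
    moreover have "lead_coeff (\<Prod>s<j. [:of_nat (Suc s) :: rat, 1:]) = 1"
      by (subst lead_coeff_prod) auto
    ultimately show "degree (q j) \<le> j" "coeff (q j) j = 1 / fact j"
      by (auto simp: q_def)
  qed
  have "poly (q j) (of_nat x) = of_nat ((x + j) choose j)" for x j
  proof -
    have "(\<Prod>s<j. of_nat x + of_nat (Suc s) :: rat) = pochhammer (of_nat x + 1) j"
      by (simp add: pochhammer_prod lessThan_atLeast0 add_ac)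
    then show ?thesis
      by (simp add: q_def poly_prod binomial_gbinomial gbinomial_pochhammer' add_ac)
  qed
  then have "mat n n (\<lambda>(i, j). binom_row n i (b i) j) =
      mat n n (\<lambda>(i, j). poly (q j) (of_nat (b i)))"
    by (intro eq_matI) (auto simp: binom_row_def)
  then show ?thesis
    unfolding binom_det_def using q by (simp add: det_polynomial_vandermonde)
qed

subsection \<open>Labelled rows\<close>

lemma ring_distance:
  fixes c d N :: nat
  assumes "c < N" "d < N"
  shows "(d + N - c) mod N = (if c \<le> d then d - c else d + N - c)"
  using assms by (auto simp: mod_if)

lemma first_right_in: "U \<noteq> {} \<Longrightarrow> first_right N c U \<in> U"
  unfolding first_right_def using arg_min_natI[of "\<lambda>d. d \<in> U"] by blast

text \<open>The cyclic distance from \<open>c\<close> is injective on columns below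
  \<open>N\<close>, so the minimiser chosen by \<open>ARG_MIN\<close> is unique.\<close>

lemma first_right_eq_iff:
  assumes U: "U \<subseteq> {0..<N}" and d: "d \<in> U" and c: "c < N"
  shows "first_right N c U = d \<longleftrightarrow> (\<forall>e\<in>U. (d + N - c) mod N \<le> (e + N - c) mod N)"
proof -
  let ?f = "\<lambda>d. (d + N - c) mod N"
  have least: "?f (first_right N c U) \<le> ?f e" if "e \<in> U" for e
    unfolding first_right_def using that by (intro arg_min_nat_le)
  have mem: "first_right N c U \<in> U"
    using d by (intro first_right_in) auto
  have inj: "e = e'" if "e \<in> U" "e' \<in> U" "?f e = ?f e'" for e e'
  proof -
    have "e < N" "e' < N" using U that by auto
    then show ?thesis using that(3) c by (auto simp: ring_distance split: if_splits)
  qed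
  show ?thesis
    using least mem inj d by (metis le_antisym)
qed

text \<open>This turns cyclic searches into linear inequalities. If \<open>e\<close> and
  \<open>d\<close> are neighbours in \<open>U\<close> with \<open>e < d\<close>, a search starting
  outside the interval from \<open>e + 1\<close> to \<open>d\<close> meets another box, at the
  latest \<open>e\<close>, before \<open>d\<close>.\<close>

lemma first_right_eq_iff_interval:
  assumes U: "U \<subseteq> {0..<N}" and d: "d \<in> U" and e: "e \<in> U" and "e < d" and c: "c < N"
    and gap: "\<And>x. x \<in> U \<Longrightarrow> x \<le> e \<or> d \<le> x"
  shows "first_right N c U = d \<longleftrightarrow> e < c \<and> c \<le> d"
proof -
  have lt: "x < N" if "x \<in> U" for x using U that by auto
  have "(\<forall>x\<in>U. (d + N - c) mod N \<le> (x + N - c) mod N) \<longleftrightarrow> e < c \<and> c \<le> d"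
  proof
    assume "\<forall>x\<in>U. (d + N - c) mod N \<le> (x + N - c) mod N"
    with e have "(d + N - c) mod N \<le> (e + N - c) mod N" by blast
    then show "e < c \<and> c \<le> d"
      using lt[OF d] lt[OF e] \<open>e < d\<close> c by (auto simp: ring_distance split: if_splits)
  next
    assume "e < c \<and> c \<le> d"
    then show "\<forall>x\<in>U. (d + N - c) mod N \<le> (x + N - c) mod N"
    proof (intro ballI)
      fix x assume "x \<in> U"
      then show "(d + N - c) mod N \<le> (x + N - c) mod N"
        using \<open>e < c \<and> c \<le> d\<close> gap[of x] lt[of x] lt[OF d] c by (auto simp: ring_distance)
    qed
  qed
  then show ?thesis
    using first_right_eq_iff[OF U d c] by simp
qed

lemma label_row_props:
  assumes "finite U" "card U = Suc (length cs)"
  shows "length (label_row N cs U) = Suc (length cs) \<and> set (label_row N cs U) = U \<and>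
    distinct (label_row N cs U)"
  using assms
proof (induction cs arbitrary: U)
  case Nil
  then obtain u where "U = {u}" by (auto simp: card_1_singleton_iff)
  then show ?case by simp
next
  case (Cons c cs)
  define d where "d = first_right N c U"
  have "d \<in> U"
    unfolding d_def using Cons.prems by (intro first_right_in) auto
  moreover from this Cons.prems have "card (U - {d}) = Suc (length cs)"
    by simp
  ultimately show ?case
    using Cons.IH[of "U - {d}"] Cons.prems by (auto simp: Let_def d_def[symmetric])
qed

text \<open>If the result is to be \<open>L\<close>, the boxes still unlabelled before step
  \<open>l\<close> are those in \<open>drop l L\<close>. The recursion thus becomes independent
  conditions on the entries of \<open>cs\<close>; the last box is forced.\<close>

lemma label_row_eq_iff:
  assumes "distinct L" "length L = Suc (length cs)"
  shows "label_row N cs (set L) = L \<longleftrightarrow>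
    (\<forall>l<length cs. first_right N (cs ! l) (set (drop l L)) = L ! l)"
  using assms
proof (induction cs arbitrary: L)
  case Nil
  then obtain u where "L = [u]" by (auto simp: length_Suc_conv)
  then show ?case by simp
next
  case (Cons c cs)
  then obtain d L' where L: "L = d # L'" by (cases L) auto
  with Cons.prems have rest: "set L - {d} = set L'" by auto
  have "label_row N (c # cs) (set L) = d # L' \<longleftrightarrow>
      first_right N c (set L) = d \<and> label_row N cs (set L') = L'"
    by (cases "first_right N c (set L) = d") (simp_all add: rest Let_def)
  then have "label_row N (c # cs) (set L) = L \<longleftrightarrow>
      first_right N c (set L) = d \<and> label_row N cs (set L') = L'"
    by (simp only: L)
  also have "\<dots> \<longleftrightarrow> first_right N c (set L) = d \<and>
      (\<forall>l<length cs. first_right N (cs ! l) (set (drop l L')) = L' ! l)"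
    using Cons.IH[of L'] Cons.prems by (simp add: L)
  also have "\<dots> \<longleftrightarrow> (\<forall>l<length (c # cs). first_right N ((c # cs) ! l) (set (drop l L)) = L ! l)"
    by (simp add: L All_less_Suc2)
  finally show ?case .
qed

lemma mlqs_row: "Q \<in> mlqs n N \<Longrightarrow> 1 \<le> i \<Longrightarrow> i \<le> n \<Longrightarrow> Q i \<subseteq> {0..<N} \<and> finite (Q i) \<and> card (Q i) = i"
  using finite_subset[of "Q i" "{0..<N}"] by (auto simp: mlqs_def PiE_iff)

lemma labelled_row_props:
  assumes "Q \<in> mlqs n N" "i \<le> n"
  shows "length (labelled_row N Q i) = i \<and> distinct (labelled_row N Q i) \<and>
    set (labelled_row N Q i) = (if i = 0 then {} else Q i)"
  using assms(2)
proof (induction i)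
  case (Suc i)
  then have "finite (Q (Suc i))" "card (Q (Suc i)) = Suc (length (labelled_row N Q i))"
    using mlqs_row[OF assms(1), of "Suc i"] by auto
  from label_row_props[OF this, of N] show ?case
    using Suc by simp
qed simp

lemma labelled_row_cong:
  "(\<And>j. 1 \<le> j \<Longrightarrow> j \<le> i \<Longrightarrow> Q j = Q' j) \<Longrightarrow> labelled_row N Q i = labelled_row N Q' i"
  by (induction i) auto

section \<open>Recursion on a prescribed labelled bottom row\<close>

definition mlq_count :: "nat \<Rightarrow> nat \<Rightarrow> nat list \<Rightarrow> nat" where
  "mlq_count N n L = card {Q \<in> mlqs n N. labelled_row N Q n = L}"

text \<open>A labelled row determines its set of boxes, so \<open>set L\<close> serves as the box
  set of the lower row.\<close>

definition rows_above :: "nat \<Rightarrow> nat list \<Rightarrow> nat list set" where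
  "rows_above N L = {cs. Suc (length cs) = length L \<and> distinct cs \<and> set cs \<subseteq> {0..<N} \<and>
     label_row N cs (set L) = L}"

lemma finite_mlqs: "finite (mlqs n N)"
  unfolding mlqs_def by (intro finite_PiE) (auto intro: finite_subset[of _ "Pow {0..<N}"])

lemma finite_rows_above: "finite (rows_above N L)"
  by (rule finite_subset[OF _ finite_lists_length_eq[of "{0..<N}" "length L - 1"]])
    (auto simp: rows_above_def)

lemma mlq_count_0: "mlq_count N 0 [] = 1"
  by (simp add: mlq_count_def mlqs_def)

text \<open>Deleting the bottom row is inverted by adding \<open>set L\<close> as row
  \<open>Suc n\<close>. The remaining MLQs are grouped by the labelled row they end in.\<close>

lemma mlq_count_Suc:
  assumes L: "distinct L" "length L = Suc n" "set L \<subseteq> {0..<N}"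
  shows "mlq_count N (Suc n) L = (\<Sum>cs\<in>rows_above N L. mlq_count N n cs)"
proof -
  let ?S = "{Q \<in> mlqs (Suc n) N. labelled_row N Q (Suc n) = L}"
  let ?T = "{Q \<in> mlqs n N. labelled_row N Q n \<in> rows_above N L}"
  have "bij_betw (\<lambda>Q. restrict Q {1..n}) ?S ?T"
  proof (rule bij_betwI[where g = "\<lambda>Q. Q(Suc n := set L)"])
    show "(\<lambda>Q. restrict Q {1..n}) \<in> ?S \<rightarrow> ?T"
    proof
      fix Q assume "Q \<in> ?S"
      then have Q: "Q \<in> mlqs (Suc n) N" "labelled_row N Q (Suc n) = L" by auto
      have "labelled_row N (restrict Q {1..n}) n = labelled_row N Q n"
        by (rule labelled_row_cong) auto
      moreover have "Q (Suc n) = set L"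
        using labelled_row_props[OF Q(1), of "Suc n"] Q(2) by simp
      moreover have "set (labelled_row N Q n) \<subseteq> {0..<N}"
        using labelled_row_props[OF Q(1), of n] mlqs_row[OF Q(1), of n] by auto
      moreover have "restrict Q {1..n} \<in> mlqs n N"
        using Q(1) by (auto simp: mlqs_def PiE_iff)
      ultimately show "restrict Q {1..n} \<in> ?T"
        using Q L labelled_row_props[OF Q(1), of n] by (simp add: rows_above_def)
    qed
  next
    show "(\<lambda>Q. Q(Suc n := set L)) \<in> ?T \<rightarrow> ?S"
    proof
      fix Q assume "Q \<in> ?T"
      then have Q: "Q \<in> mlqs n N" "labelled_row N Q n \<in> rows_above N L" by auto
      have "labelled_row N (Q(Suc n := set L)) n = labelled_row N Q n"
        by (rule labelled_row_cong) auto
      then have "labelled_row N (Q(Suc n := set L)) (Suc n) = L"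
        using Q(2) by (simp add: rows_above_def)
      moreover have "Q(Suc n := set L) \<in> mlqs (Suc n) N"
        using Q(1) L by (auto simp: mlqs_def PiE_iff extensional_def distinct_card)
      ultimately show "Q(Suc n := set L) \<in> ?S" by simp
    qed
  next
    fix Q assume Q: "Q \<in> ?S"
    then have "Q (Suc n) = set L"
      using labelled_row_props[of Q "Suc n" N "Suc n"] by auto
    then show "(restrict Q {1..n})(Suc n := set L) = Q"
      using Q by (auto simp: mlqs_def PiE_iff extensional_def fun_eq_iff)
  next
    fix Q assume "Q \<in> ?T"
    then show "restrict (Q(Suc n := set L)) {1..n} = Q"
      by (auto simp: mlqs_def PiE_iff extensional_def fun_eq_iff)
  qed
  then have "mlq_count N (Suc n) L = card ?T"
    unfolding mlq_count_def by (rule bij_betw_same_card)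
  also have "?T = (\<Union>cs\<in>rows_above N L. {Q \<in> mlqs n N. labelled_row N Q n = cs})"
    by auto
  also have "card \<dots> = (\<Sum>cs\<in>rows_above N L. mlq_count N n cs)"
    unfolding mlq_count_def
    by (intro card_UN_disjoint finite_rows_above ballI impI) (auto simp: finite_mlqs)
  finally show ?thesis .
qed

section \<open>Rows above a bottom row labelled by w_0 or s_k w_0\<close>

definition w0_row :: "nat \<Rightarrow> (nat \<Rightarrow> nat) \<Rightarrow> nat list" where
  "w0_row n b = map (\<lambda>l. b (n - Suc l)) [0..<n]"

text \<open>Here \<open>p\<close> stands for \<open>k - 1\<close>: list indices \<open>p\<close> and
  \<open>Suc p\<close> hold the columns of the labels k and k+1. Positions in \<open>b\<close> count
  from 0, hence label \<open>l + 1\<close> of the reverse permutation sits at position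
  \<open>n - Suc l\<close>.\<close>

definition swap_row :: "nat \<Rightarrow> nat \<Rightarrow> (nat \<Rightarrow> nat) \<Rightarrow> nat list" where
  "swap_row n p b = map (\<lambda>l. b (n - Suc (Transposition.transpose p (Suc p) l))) [0..<n]"

lemma length_rows [simp]: "length (w0_row n b) = n" "length (swap_row n p b) = n"
  by (simp_all add: w0_row_def swap_row_def)

lemma nth_w0_row [simp]: "l < n \<Longrightarrow> w0_row n b ! l = b (n - Suc l)"
  by (simp add: w0_row_def)

lemma nth_swap_row [simp]:
  "l < n \<Longrightarrow> swap_row n p b ! l = b (n - Suc (Transposition.transpose p (Suc p) l))"
  by (simp add: swap_row_def)

lemma set_w0_row: "set (w0_row n b) = b ` {..<n}"
proof -
  have "(\<lambda>l. n - Suc l) ` {0..<n} = {..<n}"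
  proof (intro equalityI subsetI)
    fix x assume "x \<in> {..<n}"
    then show "x \<in> (\<lambda>l. n - Suc l) ` {0..<n}"
      by (intro image_eqI[of _ _ "n - Suc x"]) auto
  qed auto
  then show ?thesis
    by (simp add: w0_row_def image_image[of b "\<lambda>l. n - Suc l", symmetric])
qed

lemma transpose_lt: "Suc p < n \<Longrightarrow> l < n \<Longrightarrow> Transposition.transpose p (Suc p) l < n"
  by (auto simp: Transposition.transpose_def)

lemma set_swap_row:
  assumes "Suc p < n"
  shows "set (swap_row n p b) = b ` {..<n}"
proof -
  have "Transposition.transpose p (Suc p) ` {0..<n} = {0..<n}"
    using assms by (intro transpose_image_eq) auto
  then have "set (swap_row n p b) = (\<lambda>l. b (n - Suc l)) ` {0..<n}"
    unfolding swap_row_def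
    by (simp add: image_image[of "\<lambda>l. b (n - Suc l)" "Transposition.transpose p (Suc p)", symmetric])
  also have "\<dots> = set (w0_row n b)" by (simp add: w0_row_def)
  finally show ?thesis by (simp add: set_w0_row)
qed

lemma distinct_rows:
  assumes "strict_mono_on {..<n} b"
  shows "distinct (w0_row n b)" and "Suc p < n \<Longrightarrow> distinct (swap_row n p b)"
proof -
  have "card (b ` {..<n}) = n"
    using strict_mono_on_imp_inj_on[OF assms] by (simp add: card_image)
  then show "distinct (w0_row n b)" "Suc p < n \<Longrightarrow> distinct (swap_row n p b)"
    by (auto intro!: card_distinct simp: set_w0_row set_swap_row)
qed

lemma set_drop_conv: "x \<in> set (drop l L) \<longleftrightarrow> (\<exists>i. l \<le> i \<and> i < length L \<and> x = L ! i)"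
proof
  assume "x \<in> set (drop l L)"
  then obtain i where "i < length L - l" "x = drop l L ! i"
    by (auto simp: in_set_conv_nth)
  then show "\<exists>i. l \<le> i \<and> i < length L \<and> x = L ! i"
    by (intro exI[of _ "l + i"]) (auto simp: add.commute)
next
  assume "\<exists>i. l \<le> i \<and> i < length L \<and> x = L ! i"
  then obtain i where "l \<le> i" "i < length L" "x = L ! i" by blast
  then show "x \<in> set (drop l L)"
    by (auto simp: in_set_conv_nth intro!: exI[of _ "i - l"])
qed

lemma strict_mono_on_lt:
  fixes b :: "nat \<Rightarrow> nat"
  shows "strict_mono_on {..<n} b \<Longrightarrow> i < j \<Longrightarrow> j < n \<Longrightarrow> b i < b j"
  by (rule strict_mono_onD[of "{..<n}" b]) auto

lemma strict_mono_on_le: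
  fixes b :: "nat \<Rightarrow> nat"
  shows "strict_mono_on {..<n} b \<Longrightarrow> i \<le> j \<Longrightarrow> j < n \<Longrightarrow> b i \<le> b j"
  by (cases "i = j") (simp_all add: strict_mono_on_lt[of n b i j] less_imp_le)

lemma loose_interlacingsD:
  assumes "c \<in> loose_interlacings n a b"
  shows "i < n \<Longrightarrow> i \<noteq> Suc a \<Longrightarrow> b i < c i" "i < n \<Longrightarrow> i \<noteq> Suc a \<Longrightarrow> c i \<le> b (Suc i)"
    "Suc a < n \<Longrightarrow> c (Suc a) \<le> b (Suc (Suc a))" "c a < c (Suc a)"
proof -
  have c: "c i \<in> (if i = Suc a then {b a<..b (Suc (Suc a))} else {b i<..b (Suc i)})" if "i < n" for i
    using assms that by (auto simp only: loose_interlacings_def intro: PiE_mem)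
  show "i < n \<Longrightarrow> i \<noteq> Suc a \<Longrightarrow> b i < c i" "i < n \<Longrightarrow> i \<noteq> Suc a \<Longrightarrow> c i \<le> b (Suc i)"
    using c[of i] by simp_all
  show "Suc a < n \<Longrightarrow> c (Suc a) \<le> b (Suc (Suc a))"
    using c[of "Suc a"] by simp
  show "c a < c (Suc a)"
    using assms by (simp add: loose_interlacings_def)
qed

context
  fixes n N :: nat and b :: "nat \<Rightarrow> nat"
  assumes mono: "strict_mono_on {..<Suc n} b" and bound: "b n < N"
begin

lemma image_lt: "b ` {..<Suc n} \<subseteq> {0..<N}"
proof
  fix x assume "x \<in> b ` {..<Suc n}"
  then obtain i where "x = b i" "i < Suc n" by blast
  then show "x \<in> {0..<N}"
    using strict_mono_on_le[OF mono, of i n] bound by simp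
qed

text \<open>Before step \<open>l\<close> the unlabelled boxes are \<open>b 0\<close> to
  \<open>b (n - l)\<close>. The target is the rightmost of them and its left neighbour is
  \<open>b (n - Suc l)\<close>, so no admissible search wraps around.\<close>

lemma rows_above_w0_row:
  "cs \<in> rows_above N (w0_row (Suc n) b) \<longleftrightarrow> length cs = n \<and> distinct cs \<and> set cs \<subseteq> {0..<N} \<and>
     (\<forall>l<n. b (n - Suc l) < cs ! l \<and> cs ! l \<le> b (n - l))"
proof -
  have "first_right N (cs ! l) (set (drop l (w0_row (Suc n) b))) = w0_row (Suc n) b ! l \<longleftrightarrow>
      b (n - Suc l) < cs ! l \<and> cs ! l \<le> b (n - l)"
    if cs: "length cs = n" "set cs \<subseteq> {0..<N}" and l: "l < n" for l
  proof -
    let ?U = "set (drop l (w0_row (Suc n) b))"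
    have U: "x \<in> ?U \<longleftrightarrow> (\<exists>i. l \<le> i \<and> i \<le> n \<and> x = b (n - i))" for x
      by (auto simp: set_drop_conv)
    have "?U \<subseteq> {0..<N}"
      using set_drop_subset[of l "w0_row (Suc n) b"] image_lt by (auto simp: set_w0_row)
    moreover have "x \<le> b (n - Suc l) \<or> b (n - l) \<le> x" if "x \<in> ?U" for x
    proof -
      from that obtain i where "l \<le> i" "i \<le> n" "x = b (n - i)" unfolding U by blast
      then show ?thesis
        using strict_mono_on_le[OF mono, of "n - i" "n - Suc l"] by (cases "i = l") auto
    qed
    moreover have "b (n - Suc l) < b (n - l)"
      using l by (intro strict_mono_on_lt[OF mono]) auto
    moreover have "b (n - l) \<in> ?U" "b (n - Suc l) \<in> ?U"
      unfolding U using l by (auto intro: exI[of _ l] exI[of _ "Suc l"])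
    moreover have "cs ! l < N"
      using cs l nth_mem[of l cs] by (auto simp del: nth_mem)
    ultimately have "first_right N (cs ! l) ?U = b (n - l) \<longleftrightarrow>
        b (n - Suc l) < cs ! l \<and> cs ! l \<le> b (n - l)"
      by (intro first_right_eq_iff_interval)
    then show ?thesis using l by simp
  qed
  moreover have "cs \<in> rows_above N (w0_row (Suc n) b) \<longleftrightarrow>
      length cs = n \<and> distinct cs \<and> set cs \<subseteq> {0..<N} \<and> (\<forall>l<n.
        first_right N (cs ! l) (set (drop l (w0_row (Suc n) b))) = w0_row (Suc n) b ! l)"
    unfolding rows_above_def
    using label_row_eq_iff[OF distinct_rows(1)[OF mono], of cs N] by auto
  ultimately show ?thesis by blast
qed

lemma rows_above_swap_row:
  assumes p: "Suc p < n"
  shows "cs \<in> rows_above N (swap_row (Suc n) p b) \<longleftrightarrow>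
    length cs = n \<and> distinct cs \<and> set cs \<subseteq> {0..<N} \<and>
    (\<forall>l<n. l \<noteq> p \<longrightarrow> l \<noteq> Suc p \<longrightarrow> b (n - Suc l) < cs ! l \<and> cs ! l \<le> b (n - l)) \<and>
    b (n - Suc (Suc p)) < cs ! p \<and> cs ! p \<le> b (n - Suc p) \<and>
    b (n - Suc (Suc p)) < cs ! Suc p \<and> cs ! Suc p \<le> b (n - p)"
proof -
  let ?t = "Transposition.transpose p (Suc p)"
  \<comment> \<open>The position of the left neighbour of the target among the unlabelled boxes. At
    step \<open>p\<close> the box to the right of the target is still free; at step
    \<open>Suc p\<close> the box between the target and \<open>n - Suc (Suc p)\<close> is taken.
    Both intervals therefore start at the same place.\<close>
  define lo where "lo l = (if l = p \<or> l = Suc p then n - Suc (Suc p) else n - Suc l)" for l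
  have "first_right N (cs ! l) (set (drop l (swap_row (Suc n) p b))) = swap_row (Suc n) p b ! l \<longleftrightarrow>
      b (lo l) < cs ! l \<and> cs ! l \<le> b (n - ?t l)"
    if cs: "length cs = n" "set cs \<subseteq> {0..<N}" and l: "l < n" for l
  proof -
    let ?U = "set (drop l (swap_row (Suc n) p b))"
    have U: "x \<in> ?U \<longleftrightarrow> (\<exists>i. l \<le> i \<and> i \<le> n \<and> x = b (n - ?t i))" for x
      by (auto simp: set_drop_conv)
    have "?U \<subseteq> {0..<N}"
      using set_drop_subset[of l "swap_row (Suc n) p b"] image_lt p by (auto simp: set_swap_row)
    moreover have "x \<le> b (lo l) \<or> b (n - ?t l) \<le> x" if "x \<in> ?U" for x
    proof -
      from that obtain i where i: "l \<le> i" "i \<le> n" "x = b (n - ?t i)" unfolding U by blast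
      have "n - ?t i \<le> lo l \<or> n - ?t l \<le> n - ?t i"
        using i(1,2) l p by (auto simp: lo_def Transposition.transpose_def)
      moreover have "lo l < Suc n" by (auto simp: lo_def)
      moreover have "n - ?t i < Suc n" by simp
      ultimately show ?thesis
        unfolding i(3) using strict_mono_on_le[OF mono] by blast
    qed
    moreover have "b (lo l) < b (n - ?t l)"
      using l p by (intro strict_mono_on_lt[OF mono]) (auto simp: lo_def Transposition.transpose_def)
    moreover have "b (n - ?t l) \<in> ?U"
      unfolding U using l by auto
    moreover have "b (lo l) \<in> ?U"
      unfolding U using l p
      \<comment> \<open>The witness is the list index at which the left neighbour occurs; it has to
        be at least \<open>l\<close>, since that box is still unlabelled.\<close>
      by (intro exI[of _ "if l = p \<or> l = Suc p then Suc (Suc p) else ?t (Suc l)"])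
        (auto simp: lo_def Transposition.transpose_def)
    moreover have "cs ! l < N"
      using cs l nth_mem[of l cs] by (auto simp del: nth_mem)
    ultimately have "first_right N (cs ! l) ?U = b (n - ?t l) \<longleftrightarrow>
        b (lo l) < cs ! l \<and> cs ! l \<le> b (n - ?t l)"
      by (intro first_right_eq_iff_interval)
    then show ?thesis using l by simp
  qed
  moreover have "cs \<in> rows_above N (swap_row (Suc n) p b) \<longleftrightarrow>
      length cs = n \<and> distinct cs \<and> set cs \<subseteq> {0..<N} \<and> (\<forall>l<n.
        first_right N (cs ! l) (set (drop l (swap_row (Suc n) p b))) = swap_row (Suc n) p b ! l)"
    unfolding rows_above_def
    using label_row_eq_iff[OF distinct_rows(2)[OF mono], of p cs N] p by auto
  ultimately have "cs \<in> rows_above N (swap_row (Suc n) p b) \<longleftrightarrow>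
    length cs = n \<and> distinct cs \<and> set cs \<subseteq> {0..<N} \<and>
    (\<forall>l<n. b (lo l) < cs ! l \<and> cs ! l \<le> b (n - ?t l))"
    by blast
  also have "(\<forall>l<n. b (lo l) < cs ! l \<and> cs ! l \<le> b (n - ?t l)) \<longleftrightarrow>
    (\<forall>l<n. l \<noteq> p \<longrightarrow> l \<noteq> Suc p \<longrightarrow> b (n - Suc l) < cs ! l \<and> cs ! l \<le> b (n - l)) \<and>
    b (n - Suc (Suc p)) < cs ! p \<and> cs ! p \<le> b (n - Suc p) \<and>
    b (n - Suc (Suc p)) < cs ! Suc p \<and> cs ! Suc p \<le> b (n - p)"
    using p by (auto simp: lo_def Transposition.transpose_def)
  finally show ?thesis .
qed

lemma interlacing_props:
  assumes "c \<in> PiE {..<n} (\<lambda>i. {b i<..b (Suc i)})"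
  shows "strict_mono_on {..<n} c" "c ` {..<n} \<subseteq> {0..<N}"
proof -
  have c: "b i < c i" "c i \<le> b (Suc i)" if "i < n" for i
    using assms that by (auto simp: PiE_iff)
  show "strict_mono_on {..<n} c"
  proof (rule strict_mono_onI)
    fix i j assume "i \<in> {..<n}" "j \<in> {..<n}" "i < j"
    then show "c i < c j"
      using c[of i] c[of j] strict_mono_on_le[OF mono, of "Suc i" j] by auto
  qed
  show "c ` {..<n} \<subseteq> {0..<N}"
  proof
    fix x assume "x \<in> c ` {..<n}"
    then obtain i where "i < n" "x = c i" by blast
    then show "x \<in> {0..<N}"
      using c(2)[of i] strict_mono_on_le[OF mono, of "Suc i" n] bound by auto
  qed
qed

text \<open>The intervals in \<open>rows_above_w0_row\<close> are disjoint and move left as the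
  label grows, so the row above is decreasing and is itself a \<open>w0_row\<close>.\<close>

lemma mlq_count_w0_row:
  "mlq_count N (Suc n) (w0_row (Suc n) b) =
    (\<Sum>c\<in>PiE {..<n} (\<lambda>i. {b i<..b (Suc i)}). mlq_count N n (w0_row n c))"
proof -
  have "mlq_count N (Suc n) (w0_row (Suc n) b) =
      (\<Sum>cs\<in>rows_above N (w0_row (Suc n) b). mlq_count N n cs)"
    using image_lt by (intro mlq_count_Suc distinct_rows[OF mono]) (auto simp: set_w0_row)
  also have "\<dots> = (\<Sum>c\<in>PiE {..<n} (\<lambda>i. {b i<..b (Suc i)}). mlq_count N n (w0_row n c))"
  proof (rule sum.reindex_bij_witness[symmetric,
        where j = "w0_row n" and i = "\<lambda>cs. \<lambda>i\<in>{..<n}. cs ! (n - Suc i)"])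
    fix c assume c: "c \<in> PiE {..<n} (\<lambda>i. {b i<..b (Suc i)})"
    show "restrict (\<lambda>i. w0_row n c ! (n - Suc i)) {..<n} = c"
      using c by (auto simp: PiE_iff extensional_def fun_eq_iff)
    have "b (n - Suc l) < c (n - Suc l) \<and> c (n - Suc l) \<le> b (n - l)" if "l < n" for l
    proof -
      have "c (n - Suc l) \<in> {b (n - Suc l)<..b (Suc (n - Suc l))}"
        using c that by (intro PiE_mem[OF c]) auto
      then show ?thesis using that by (simp add: Suc_diff_Suc)
    qed
    then show "w0_row n c \<in> rows_above N (w0_row (Suc n) b)"
      using interlacing_props[OF c] distinct_rows by (auto simp: rows_above_w0_row set_w0_row)
  next
    fix cs assume "cs \<in> rows_above N (w0_row (Suc n) b)"
    then have cs: "length cs = n" "\<And>l. l < n \<Longrightarrow> b (n - Suc l) < cs ! l \<and> cs ! l \<le> b (n - l)"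
      unfolding rows_above_w0_row by auto
    show "w0_row n (\<lambda>i\<in>{..<n}. cs ! (n - Suc i)) = cs"
      using cs(1) by (intro nth_equalityI) auto
    show "(\<lambda>i\<in>{..<n}. cs ! (n - Suc i)) \<in> PiE {..<n} (\<lambda>i. {b i<..b (Suc i)})"
    proof
      fix i assume "i \<in> {..<n}"
      then show "(\<lambda>i\<in>{..<n}. cs ! (n - Suc i)) i \<in> {b i<..b (Suc i)}"
        using cs(2)[of "n - Suc i"] by (auto simp: Suc_diff_Suc)
    qed auto
  qed simp
  finally show ?thesis .
qed

lemma loose_interlacing_props:
  assumes c: "c \<in> loose_interlacings n a b" and a: "Suc a < n"
  shows "strict_mono_on {..<n} c" "c ` {..<n} \<subseteq> {0..<N}"
proof -
  note c1 = loose_interlacingsD(1,2)[OF c] and c2 = loose_interlacingsD(4,3)[OF c] a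
  have c3: "c i \<le> b (Suc i)" if "i < n" for i
    using c1(2)[of i] c2 that by (cases "i = Suc a") auto
  show "strict_mono_on {..<n} c"
  proof (rule strict_mono_onI)
    fix i j assume ij: "i \<in> {..<n}" "j \<in> {..<n}" "i < j"
    show "c i < c j"
    proof (cases "j = Suc a")
      case True
      have "c i \<le> c a"
        using ij True c3[of i] c1(1)[of a] strict_mono_on_le[OF mono, of "Suc i" a]
        by (cases "i = a") auto
      then show ?thesis using c2 True by simp
    next
      case False
      then show ?thesis
        using ij c3[of i] c1(1)[of j] strict_mono_on_le[OF mono, of "Suc i" j] by auto
    qed
  qed
  show "c ` {..<n} \<subseteq> {0..<N}"
  proof
    fix x assume "x \<in> c ` {..<n}"
    then obtain i where "x = c i" "i < n" by blast
    then show "x \<in> {0..<N}"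
      using c3[of i] strict_mono_on_le[OF mono, of "Suc i" n] bound by auto
  qed
qed

text \<open>Only the union of the two sets of rows has a description that is symmetric in the labels
  \<open>p + 1\<close> and \<open>p + 2\<close>; this is why the two counts are added.\<close>
lemma rows_above_union:
  assumes p: "Suc p < n"
  shows "rows_above N (w0_row (Suc n) b) \<union> rows_above N (swap_row (Suc n) p b) =
    w0_row n ` loose_interlacings n (n - Suc (Suc p)) b \<union>
    swap_row n p ` loose_interlacings n (n - Suc (Suc p)) b"
proof -
  define a where "a = n - Suc (Suc p)"
  have n: "n = Suc (Suc (a + p))" using p by (simp add: a_def)
  let ?t = "Transposition.transpose p (Suc p)"
  have b_lt: "b a < b (Suc a)" "b (Suc a) < b (Suc (Suc a))"
    by (rule strict_mono_on_lt[OF mono]; simp add: n)+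
  \<comment> \<open>The entries at \<open>p\<close> and \<open>Suc p\<close> occur only through
    their minimum and maximum, so the condition is blind to which of the two boxes has the smaller
    label.\<close>
  define loose where "loose cs \<longleftrightarrow>
    (\<forall>l<n. l \<noteq> p \<longrightarrow> l \<noteq> Suc p \<longrightarrow> b (n - Suc l) < cs ! l \<and> cs ! l \<le> b (n - l)) \<and>
    b a < min (cs ! p) (cs ! Suc p) \<and> min (cs ! p) (cs ! Suc p) \<le> b (Suc a) \<and>
    max (cs ! p) (cs ! Suc p) \<le> b (Suc (Suc a))" for cs
  \<comment> \<open>If \<open>cs ! p\<close> is the larger entry, it lies either beyond
    \<open>b (Suc a)\<close>, the case of \<open>w0_row\<close>, or before it, the case of
    \<open>swap_row\<close>. If it is the smaller one, only \<open>swap_row\<close> is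
    possible.\<close>
  have union: "cs \<in> rows_above N (w0_row (Suc n) b) \<union> rows_above N (swap_row (Suc n) p b) \<longleftrightarrow>
    length cs = n \<and> distinct cs \<and> set cs \<subseteq> {0..<N} \<and> loose cs" for cs
  proof -
    have split: "(\<forall>l<n. P l) \<longleftrightarrow> (\<forall>l<n. l \<noteq> p \<longrightarrow> l \<noteq> Suc p \<longrightarrow> P l) \<and> P p \<and> P (Suc p)" for P
      using p by (metis Suc_lessD)
    have diffs: "n - Suc (Suc p) = a" "n - Suc p = Suc a" "n - p = Suc (Suc a)"
      by (simp_all add: n)
    have "cs ! p \<noteq> cs ! Suc p" if "length cs = n" "distinct cs"
      using that p by (simp add: nth_eq_iff_index_eq)
    then show ?thesis
      using b_lt
      unfolding Un_iff rows_above_w0_row rows_above_swap_row[OF p] loose_def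
        split[of "\<lambda>l. b (n - Suc l) < cs ! l \<and> cs ! l \<le> b (n - l)"] diffs
      by (auto simp: min_def max_def)
  qed
  have loose_rows: "loose (w0_row n c)" "loose (swap_row n p c)"
    if c: "c \<in> loose_interlacings n a b" for c
  proof -
    note c' = loose_interlacingsD[OF c]
    have c'': "b (n - Suc l) < c (n - Suc l) \<and> c (n - Suc l) \<le> b (n - l)"
      if "l < n" "l \<noteq> p" for l
    proof -
      have "n - Suc l < n" "n - Suc l \<noteq> Suc a" "Suc (n - Suc l) = n - l"
        using that by (auto simp: n)
      then show ?thesis using c'(1,2)[of "n - Suc l"] by simp
    qed
    have "c a < c (Suc a)" "c (Suc a) \<le> b (Suc (Suc a))" "b a < c a" "c a \<le> b (Suc a)"
      using c'(1,2)[of a] c'(3,4) by (simp_all add: n)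
    moreover have "n - Suc p = Suc a" "n - Suc (Suc p) = a" "p < n"
      by (simp_all add: n)
    ultimately show "loose (w0_row n c)" "loose (swap_row n p c)"
      using c'' p unfolding loose_def by (simp_all add: transpose_apply_other)
  qed
  show ?thesis
    unfolding a_def[symmetric]
  proof (intro equalityI subsetI)
    fix cs assume "cs \<in> w0_row n ` loose_interlacings n a b \<union> swap_row n p ` loose_interlacings n a b"
    then obtain c where c: "c \<in> loose_interlacings n a b" "cs = w0_row n c \<or> cs = swap_row n p c"
      by blast
    have props: "strict_mono_on {..<n} c" "c ` {..<n} \<subseteq> {0..<N}"
      using loose_interlacing_props[OF c(1)] by (auto simp: n)
    show "cs \<in> rows_above N (w0_row (Suc n) b) \<union> rows_above N (swap_row (Suc n) p b)"
      using c(2) loose_rows[OF c(1)] props(2) distinct_rows[OF props(1)] p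
      unfolding union by (auto simp: set_w0_row set_swap_row)
  next
    fix cs assume "cs \<in> rows_above N (w0_row (Suc n) b) \<union> rows_above N (swap_row (Suc n) p b)"
    then have cs: "length cs = n" "distinct cs" "loose cs"
      unfolding union by auto
    have ne: "cs ! p \<noteq> cs ! Suc p"
      using cs p by (simp add: nth_eq_iff_index_eq)
    have mid: "b i < cs ! (n - Suc i) \<and> cs ! (n - Suc i) \<le> b (Suc i)"
      if "i < n" "i \<noteq> a" "i \<noteq> Suc a" for i
    proof -
      have "n - Suc i < n" "n - Suc i \<noteq> p" "n - Suc i \<noteq> Suc p" "n - Suc (n - Suc i) = i"
        "n - (n - Suc i) = Suc i"
        using that by (auto simp: n)
      then show ?thesis
        using cs(3) unfolding loose_def by metis
    qed
    have bounds: "b a < min (cs ! p) (cs ! Suc p)" "min (cs ! p) (cs ! Suc p) \<le> b (Suc a)"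
      "max (cs ! p) (cs ! Suc p) \<le> b (Suc (Suc a))"
      using cs(3) unfolding loose_def by blast+
    have in_loose: "c \<in> loose_interlacings n a b"
      if c: "c \<in> extensional {..<n}" "c a = min (cs ! p) (cs ! Suc p)"
        "c (Suc a) = max (cs ! p) (cs ! Suc p)"
        "\<And>i. i < n \<Longrightarrow> i \<noteq> a \<Longrightarrow> i \<noteq> Suc a \<Longrightarrow> c i = cs ! (n - Suc i)" for c
    proof -
      have "c i \<in> (if i = Suc a then {b a<..b (Suc (Suc a))} else {b i<..b (Suc i)})"
        if "i < n" for i
      proof -
        consider "i = a" | "i = Suc a" | "i \<noteq> a" "i \<noteq> Suc a" by blast
        then show ?thesis
          by cases (use that mid[of i] c(2-4) bounds in auto)
      qed
      moreover have "c a < c (Suc a)"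
        unfolding c(2,3) using ne by (auto simp: min_def max_def)
      ultimately show ?thesis
        using c(1) unfolding loose_interlacings_def PiE_iff by blast
    qed
    have fix_mid: "?t (n - Suc i) = n - Suc i" if "i < n" "i \<noteq> a" "i \<noteq> Suc a" for i
      using that by (auto simp: n Transposition.transpose_def)
    show "cs \<in> w0_row n ` loose_interlacings n a b \<union> swap_row n p ` loose_interlacings n a b"
    \<comment> \<open>The order of the two entries decides which of the two labellings the upper row
      carries; sorting them gives the loose interlacing \<open>c\<close>.\<close>
    proof (cases "cs ! Suc p < cs ! p")
      case True
      define c where "c = (\<lambda>i\<in>{..<n}. cs ! (n - Suc i))"
      have "cs = w0_row n c"
        using cs(1) by (intro nth_equalityI) (auto simp: c_def)
      moreover have ca: "c a = cs ! Suc p" "c (Suc a) = cs ! p"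
        by (simp_all add: c_def n)
      have "c \<in> loose_interlacings n a b"
        by (rule in_loose) (use True ca in \<open>simp_all add: c_def\<close>)
      ultimately show ?thesis by blast
    next
      case False
      define c where "c = (\<lambda>i\<in>{..<n}. cs ! ?t (n - Suc i))"
      have "cs = swap_row n p c"
      proof (rule nth_equalityI)
        fix l assume "l < length cs"
        then have l: "l < n" "?t l < n" "n - Suc (n - Suc (?t l)) = ?t l"
          using cs(1) transpose_lt[OF p, of l] by simp_all
        then show "cs ! l = swap_row n p c ! l" by (simp add: c_def)
      qed (simp add: cs(1))
      moreover have ca: "c a = cs ! p" "c (Suc a) = cs ! Suc p"
        by (simp_all add: c_def n)
      have "c \<in> loose_interlacings n a b"
        by (rule in_loose) (use False ca fix_mid in \<open>simp_all add: c_def\<close>)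
      ultimately show ?thesis by blast
    qed
  qed
qed

text \<open>The two sets of upper rows are disjoint, and so are the two images that make up their
  union, so the sum of both counts satisfies a recursion of its own.\<close>

lemma mlq_count_w0_swap:
  assumes p: "Suc p < n"
  shows "mlq_count N (Suc n) (w0_row (Suc n) b) + mlq_count N (Suc n) (swap_row (Suc n) p b) =
    (\<Sum>c\<in>loose_interlacings n (n - Suc (Suc p)) b.
      mlq_count N n (w0_row n c) + mlq_count N n (swap_row n p c))"
proof -
  let ?C = "loose_interlacings n (n - Suc (Suc p)) b"
  have mono_c: "strict_mono_on {..<n} c" if "c \<in> ?C" for c
    using loose_interlacing_props(1)[OF that] p by simp
  have ext: "c = c'" if "c \<in> ?C" "c' \<in> ?C" "\<And>i. i < n \<Longrightarrow> c i = c' i" for c c'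
    using that by (intro PiE_ext[of c "{..<n}" _ c']) (auto simp: loose_interlacings_def)
  have inj_w0: "inj_on (w0_row n) ?C"
  proof (rule inj_onI, rule ext)
    fix c c' i assume "w0_row n c = w0_row n c'" "i < n"
    then have "w0_row n c ! (n - Suc i) = w0_row n c' ! (n - Suc i)" by simp
    then show "c i = c' i" using \<open>i < n\<close> by simp
  qed auto
  have inj_swap: "inj_on (swap_row n p) ?C"
  proof (rule inj_onI, rule ext)
    fix c c' i assume eq: "swap_row n p c = swap_row n p c'" and i: "i < n"
    define l where "l = Transposition.transpose p (Suc p) (n - Suc i)"
    have "l < n" unfolding l_def using p i by (intro transpose_lt) auto
    moreover have "n - Suc (Transposition.transpose p (Suc p) l) = i"
      using i by (simp add: l_def)
    ultimately show "c i = c' i"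
      using arg_cong[OF eq, of "\<lambda>cs. cs ! l"] by simp
  qed auto
  \<comment> \<open>Equality would make the entries at \<open>p\<close> and \<open>Suc p\<close>
    both decreasing and increasing. The length is generalised because the fact is applied to the
    lower and to the upper rows.\<close>
  have disjoint: "w0_row n c \<noteq> swap_row n p c'"
    if "strict_mono_on {..<n} c" "strict_mono_on {..<n} c'" "Suc p < n" for n c c'
  proof
    assume eq: "w0_row n c = swap_row n p c'"
    have "c (n - Suc (Suc p)) < c (n - Suc p)"
      using that(3) by (intro strict_mono_on_lt[OF that(1)]) auto
    moreover have "c' (n - Suc (Suc p)) < c' (n - Suc p)"
      using that(3) by (intro strict_mono_on_lt[OF that(2)]) auto
    ultimately show False
      using arg_cong[OF eq, of "\<lambda>cs. cs ! p"] arg_cong[OF eq, of "\<lambda>cs. cs ! Suc p"] that(3)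
      by simp
  qed
  have "set (swap_row (Suc n) p b) = set (w0_row (Suc n) b)"
    using p by (simp add: set_w0_row set_swap_row)
  then have disjoint_above:
    "rows_above N (w0_row (Suc n) b) \<inter> rows_above N (swap_row (Suc n) p b) = {}"
    using disjoint[OF mono mono] p by (auto simp: rows_above_def)
  have "mlq_count N (Suc n) (w0_row (Suc n) b) + mlq_count N (Suc n) (swap_row (Suc n) p b) =
      (\<Sum>cs\<in>rows_above N (w0_row (Suc n) b). mlq_count N n cs) +
      (\<Sum>cs\<in>rows_above N (swap_row (Suc n) p b). mlq_count N n cs)"
    using image_lt p
    by (intro arg_cong2[where f = "(+)"] mlq_count_Suc distinct_rows[OF mono])
      (auto simp: set_w0_row set_swap_row)
  also have "\<dots> = (\<Sum>cs\<in>rows_above N (w0_row (Suc n) b) \<union> rows_above N (swap_row (Suc n) p b).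
      mlq_count N n cs)"
    by (intro sum.union_disjoint[symmetric] finite_rows_above disjoint_above)
  also have "\<dots> = (\<Sum>cs\<in>w0_row n ` ?C. mlq_count N n cs) + (\<Sum>cs\<in>swap_row n p ` ?C. mlq_count N n cs)"
    unfolding rows_above_union[OF p] using mono_c disjoint p
    by (intro sum.union_disjoint finite_imageI finite_loose_interlacings) blast
  finally show ?thesis
    by (simp add: sum.reindex inj_w0 inj_swap sum.distrib)
qed

end

subsection \<open>Counting\<close>

lemma mlq_count_w0_row_eq_det:
  assumes "strict_mono_on {..<n} b" "b ` {..<n} \<subseteq> {0..<N}"
  shows "of_nat (mlq_count N n (w0_row n b)) = binom_det n n b"
  using assms
proof (induction n arbitrary: b)
  case 0
  then show ?case by (simp add: w0_row_def mlq_count_0 binom_det_def)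
next
  case (Suc n)
  note mono = Suc.prems(1)
  have bound: "b n < N" using Suc.prems(2) by auto
  have "binom_det (Suc n) (Suc n) b =
      (\<Sum>c\<in>PiE {..<n} (\<lambda>i. {b i<..b (Suc i)}). binom_det n n c)"
    by (rule binom_det_interlace) (auto intro: strict_mono_on_le[OF mono])
  also have "\<dots> = (\<Sum>c\<in>PiE {..<n} (\<lambda>i. {b i<..b (Suc i)}). of_nat (mlq_count N n (w0_row n c)))"
    by (intro sum.cong refl Suc.IH[symmetric]) (erule interlacing_props[OF mono bound])+
  finally show ?case
    by (simp add: mlq_count_w0_row[OF mono bound])
qed

section \<open>Base cases on the ring, where searches may wrap around\<close>

lemma mlq_count_1:
  assumes "x < N"
  shows "mlq_count N 1 [x] = 1"
proof -
  have "rows_above N [x] = {[]}"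
    by (auto simp: rows_above_def)
  then show ?thesis
    using assms by (simp add: mlq_count_Suc mlq_count_0)
qed

lemma mlq_count_2:
  assumes "x < N" "y < N" "x \<noteq> y"
  shows "mlq_count N 2 [x, y] = card {a \<in> {0..<N}. first_right N a {x, y} = x}"
proof -
  have mem: "[a] \<in> rows_above N [x, y] \<longleftrightarrow> a < N \<and> first_right N a {x, y} = x" for a
    using label_row_eq_iff[of "[x, y]" "[a]" N] assms
    by (simp add: rows_above_def del: label_row.simps)
  have "rows_above N [x, y] = (\<lambda>a. [a]) ` {a \<in> {0..<N}. first_right N a {x, y} = x}"
  proof (intro equalityI subsetI)
    fix cs assume cs: "cs \<in> rows_above N [x, y]"
    then have "length cs = 1" by (simp add: rows_above_def)
    then obtain a where "cs = [a]" by (auto simp: length_Suc_conv)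
    with cs show "cs \<in> (\<lambda>a. [a]) ` {a \<in> {0..<N}. first_right N a {x, y} = x}"
      by (simp add: mem)
  next
    fix cs assume "cs \<in> (\<lambda>a. [a]) ` {a \<in> {0..<N}. first_right N a {x, y} = x}"
    then obtain a where "cs = [a]" "a < N" "first_right N a {x, y} = x" by force
    then show "cs \<in> rows_above N [x, y]"
      by (simp add: mem)
  qed
  moreover have "mlq_count N 2 [x, y] = (\<Sum>cs\<in>rows_above N [x, y]. mlq_count N 1 cs)"
    using assms mlq_count_Suc[of "[x, y]" 1 N] by (simp add: numeral_2_eq_2)
  ultimately have "mlq_count N 2 [x, y] =
      (\<Sum>a\<in>{a \<in> {0..<N}. first_right N a {x, y} = x}. mlq_count N 1 [a])"
    by (simp add: sum.reindex inj_on_def)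
  then show ?thesis
    using mlq_count_1 by simp
qed

text \<open>From each of the \<open>N\<close> columns for the box in row 1, exactly one of
  \<open>x\<close> and \<open>y\<close> is met first. This is the base case for
  \<open>k = 1\<close>.\<close>

lemma mlq_count_2_sum:
  assumes "x < N" "y < N" "x \<noteq> y"
  shows "mlq_count N 2 [x, y] + mlq_count N 2 [y, x] = N"
proof -
  have "{y, x} = {x, y}" by auto
  then have "mlq_count N 2 [x, y] + mlq_count N 2 [y, x] =
      card {a \<in> {0..<N}. first_right N a {x, y} = x} + card {a \<in> {0..<N}. first_right N a {x, y} = y}"
    using assms by (simp add: mlq_count_2)
  also have "\<dots> = card ({a \<in> {0..<N}. first_right N a {x, y} = x} \<union>
      {a \<in> {0..<N}. first_right N a {x, y} = y})"
    using assms by (intro card_Un_disjoint[symmetric]) auto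
  also have "{a \<in> {0..<N}. first_right N a {x, y} = x} \<union>
      {a \<in> {0..<N}. first_right N a {x, y} = y} = {0..<N}"
    using first_right_in[of "{x, y}" N] by auto
  finally show ?thesis by simp
qed

text \<open>The count is the cyclic distance from \<open>y\<close> to \<open>x\<close>. The wrapped
  case is the complement of the unwrapped one by \<open>mlq_count_2_sum\<close>.\<close>

lemma mlq_count_2_eq:
  assumes "x < N" "y < N" "x \<noteq> y"
  shows "mlq_count N 2 [x, y] = (if y < x then x - y else N + x - y)"
proof -
  have lt: "mlq_count N 2 [u, v] = u - v" if "v < u" "u < N" for u v
  proof -
    have "first_right N a {u, v} = u \<longleftrightarrow> v < a \<and> a \<le> u" if "a < N" for a
      using that \<open>v < u\<close> \<open>u < N\<close> by (intro first_right_eq_iff_interval) auto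
    then have "{a \<in> {0..<N}. first_right N a {u, v} = u} = {v<..u}"
      using that by auto
    then show ?thesis
      using that by (simp add: mlq_count_2)
  qed
  show ?thesis
  proof (cases "y < x")
    case False
    then have "mlq_count N 2 [y, x] = y - x" using assms lt[of x y] by simp
    then show ?thesis
      using mlq_count_2_sum[OF assms] assms False by simp
  qed (use lt assms in simp)
qed

text \<open>As \<open>y\<close> runs over the other columns, its cyclic distance to \<open>x\<close>
  takes each value from 1 to \<open>N - 1\<close> once.\<close>

lemma sum_mlq_count_2:
  assumes "x < N"
  shows "(\<Sum>y\<in>{0..<N} - {x}. mlq_count N 2 [x, y]) = N choose 2"
proof -
  have "(\<Sum>y\<in>{0..<N} - {x}. mlq_count N 2 [x, y]) = (\<Sum>d\<in>{1..<N}. d)"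
    using assms
    by (intro sum.reindex_bij_witness[where j = "\<lambda>y. if y < x then x - y else N + x - y"
          and i = "\<lambda>d. if d \<le> x then x - d else N + x - d"])
      (auto simp: mlq_count_2_eq split: if_splits)
  also have "\<dots> = (\<Sum>d\<in>{0..<N}. d)"
    by (intro sum.mono_neutral_left) auto
  also have "\<dots> = N choose 2"
    by (simp add: Sum_Ico_nat choose_two)
  finally show ?thesis .
qed

text \<open>Label 1 reaches \<open>w\<close> exactly from columns \<open>x\<close> in
  \<open>{v<..w}\<close>. Label 2 then reaches one of \<open>u\<close> and \<open>v\<close> from any
  column \<open>y\<close>, so adding both cases removes the restriction on \<open>y\<close>, and
  each \<open>x\<close> contributes \<open>N choose 2\<close>.\<close>

lemma mlq_count_3_sum:
  assumes uvw: "u < v" "v < w" "w < N"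
  shows "mlq_count N 3 [w, v, u] + mlq_count N 3 [w, u, v] = (w - v) * (N choose 2)"
proof -
  \<comment> \<open>The pairs of columns of labels 1 and 2 in row 2 for which label 2 lands in
    \<open>z\<close>.\<close>
  let ?P = "\<lambda>z. {(x, y). x \<in> {v<..w} \<and> y \<in> {0..<N} - {x} \<and> first_right N y {u, v} = z}"
  let ?f = "\<lambda>(x, y). mlq_count N 2 [x, y]"
  have count: "mlq_count N 3 [w, z, z'] = sum ?f (?P z)" if z: "{z, z'} = {u, v}" "z \<noteq> z'" for z z'
  proof -
    have sets: "{w, z, z'} = {u, v, w}"
      using z by auto
    have zN: "z < N" "z' < N" "w \<noteq> z" "w \<noteq> z'"
      using z uvw by (auto simp: doubleton_eq_iff)
    have first: "first_right N x {u, v, w} = w \<longleftrightarrow> v < x \<and> x \<le> w" if "x < N" for x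
      using that uvw by (intro first_right_eq_iff_interval) auto
    have "label_row N [x, y] (set [w, z, z']) = [w, z, z'] \<longleftrightarrow>
        first_right N x {u, v, w} = w \<and> first_right N y {u, v} = z" for x y
      unfolding sets[symmetric] z(1)[symmetric]
      using label_row_eq_iff[of "[w, z, z']" "[x, y]" N] zN z(2)
      by (simp add: All_less_Suc2 del: label_row.simps)
    then have mem: "[x, y] \<in> rows_above N [w, z, z'] \<longleftrightarrow> (x, y) \<in> ?P z" for x y
      using first[of x] uvw unfolding rows_above_def
      by (auto simp del: label_row.simps)
    have "rows_above N [w, z, z'] = (\<lambda>(x, y). [x, y]) ` ?P z"
    proof (intro equalityI subsetI)
      fix cs assume cs: "cs \<in> rows_above N [w, z, z']"
      then have "length cs = 2" by (simp add: rows_above_def)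
      then obtain x y where "cs = [x, y]" by (auto simp: length_Suc_conv numeral_2_eq_2)
      with cs show "cs \<in> (\<lambda>(x, y). [x, y]) ` ?P z"
        by (intro image_eqI[of _ _ "(x, y)"]) (simp_all only: mem prod.case)
    next
      fix cs assume "cs \<in> (\<lambda>(x, y). [x, y]) ` ?P z"
      then obtain x y where "cs = [x, y]" "(x, y) \<in> ?P z" 
        by (elim imageE) (simp only: split_paired_all prod.case)
      then show "cs \<in> rows_above N [w, z, z']" by (simp only: mem)
    qed
    moreover have "mlq_count N 3 [w, z, z'] = (\<Sum>cs\<in>rows_above N [w, z, z']. mlq_count N 2 cs)"
      using zN z(2) uvw mlq_count_Suc[of "[w, z, z']" 2 N] by (simp add: numeral_3_eq_3)
    moreover have "inj_on (\<lambda>(x, y). [x, y]) (?P z)"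
      by (auto simp: inj_on_def)
    ultimately show ?thesis
      by (simp add: sum.reindex case_prod_unfold comp_def)
  qed
  have fin: "finite (?P z)" for z
    by (rule finite_subset[of _ "{v<..w} \<times> {0..<N}"]) auto
  have "mlq_count N 3 [w, v, u] + mlq_count N 3 [w, u, v] = sum ?f (?P v) + sum ?f (?P u)"
    using uvw by (intro arg_cong2[where f = "(+)"] count) auto
  also have "\<dots> = sum ?f (?P v \<union> ?P u)"
    using fin uvw by (intro sum.union_disjoint[symmetric]) auto
  also have "?P v \<union> ?P u = (SIGMA x:{v<..w}. {0..<N} - {x})"
    using first_right_in[of "{u, v}" N] by auto
  also have "sum ?f \<dots> = (\<Sum>x\<in>{v<..w}. \<Sum>y\<in>{0..<N} - {x}. mlq_count N 2 [x, y])"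
    by (rule sum.Sigma[symmetric]) auto
  also have "\<dots> = (\<Sum>x\<in>{v<..w}. N choose 2)"
    using uvw by (intro sum.cong refl sum_mlq_count_2) auto
  finally show ?thesis by simp
qed

text \<open>Induction from \<open>n = p + 2\<close>. The factor \<open>N choose Suc p\<close> arises
  in the base case, where \<open>p\<close> is 0 or 1, and the recursions of both sides carry it
  along.\<close>

lemma mlq_count_w0_swap_eq_det:
  assumes p: "p \<in> {0, 1}" and "Suc p < n"
    and "strict_mono_on {..<n} b" "b ` {..<n} \<subseteq> {0..<N}"
  shows "of_nat (mlq_count N n (w0_row n b) + mlq_count N n (swap_row n p b)) =
    of_nat (N choose Suc p) * binom_det n (n - Suc p) b"
proof -
  from \<open>Suc p < n\<close> have "Suc (Suc p) \<le> n" by simp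
  then show ?thesis
    using assms(3,4)
  proof (induction n arbitrary: b rule: dec_induct)
    case base
    have lt: "b i < N" if "i < Suc (Suc p)" for i
      using base(2) that by auto
    have mono: "b i < b j" if "i < j" "j < Suc (Suc p)" for i j
      using strict_mono_on_lt[OF base(1)] that by blast
    consider "p = 0" | "p = 1" using p by auto
    then show ?case
    proof cases
      case 1
      have "w0_row 2 b = [b 1, b 0]" "swap_row 2 0 b = [b 0, b 1]"
        by (simp_all add: w0_row_def swap_row_def upt_rec)
      then show ?thesis
        using mlq_count_2_sum[of "b 1" N "b 0"] mono[of 0 1] lt[of 0] lt[of 1] binom_det_2[of b]
        by (simp add: 1 numeral_2_eq_2)
    next
      case 2
      have "w0_row 3 b = [b 2, b 1, b 0]" "swap_row 3 1 b = [b 2, b 0, b 1]"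
        by (simp_all add: w0_row_def swap_row_def upt_rec Transposition.transpose_def)
      then show ?thesis
        using mlq_count_3_sum[of "b 0" "b 1" "b 2" N] mono[of 0 1] mono[of 1 2] lt[of 2]
          binom_det_3[of b]
        by (simp add: 2 numeral_3_eq_3[symmetric] numeral_2_eq_2[symmetric] of_nat_diff mult.commute
            del: of_nat_add)
    qed
  next
    case (step n)
    note mono = step.prems(1)
    have bound: "b n < N" using step.prems(2) by auto
    \<comment> \<open>With this \<open>a\<close> the threshold \<open>n - Suc p\<close> equals
      \<open>Suc a\<close>, and passing to \<open>Suc n\<close> raises it to
      \<open>Suc (Suc a)\<close>, as in \<open>binom_det_loose_interlace\<close>.\<close>
    define a where "a = n - Suc (Suc p)"
    have n: "n = Suc (Suc (a + p))" and p_lt: "Suc p < n"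
      using step.hyps by (simp_all add: a_def)
    have "binom_det (Suc n) (Suc n - Suc p) b = (\<Sum>c\<in>loose_interlacings n a b. binom_det n (n - Suc p) c)"
      using binom_det_loose_interlace[of n b a] strict_mono_on_le[OF mono] by (simp add: n)
    moreover have "of_nat (mlq_count N n (w0_row n c) + mlq_count N n (swap_row n p c)) =
        of_nat (N choose Suc p) * binom_det n (n - Suc p) c"
      if "c \<in> loose_interlacings n a b" for c
    proof (rule step.IH)
      have "Suc a < n" by (simp add: n)
      then show "strict_mono_on {..<n} c" "c ` {..<n} \<subseteq> {0..<N}"
        using loose_interlacing_props[OF mono bound that] by auto
    qed
    ultimately show ?case
      unfolding mlq_count_w0_swap[OF mono bound p_lt] a_def[symmetric]
      by (simp only: of_nat_sum sum_distrib_left cong: sum.cong)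
  qed
qed

section \<open>From labelled rows back to G\<close>

lemma G_eq_mlq_count:
  assumes bij: "bij_betw \<pi> {1..n} {1..n}" and len: "length L = n"
    and L: "\<And>i. i \<in> {1..n} \<Longrightarrow> L ! (\<pi> i - 1) = b i" and n: "n > 0"
  shows "G n \<pi> b N = mlq_count N n L"
proof -
  have pi_mem: "\<pi> i \<in> {1..n}" if "i \<in> {1..n}" for i
    using bij that by (auto simp: bij_betw_def)
  \<comment> \<open>Every list index is hit by some \<open>\<pi> i - 1\<close>, so prescribing the
    columns of the labels \<open>\<pi> i\<close> fixes the entire labelled row.\<close>
  have surj: "\<exists>i\<in>{1..n}. l = \<pi> i - 1" if "l < n" for l
  proof -
    have "Suc l \<in> \<pi> ` {1..n}" using bij that by (auto simp: bij_betw_def)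
    then obtain i where "i \<in> {1..n}" "\<pi> i = Suc l" by (auto simp del: image_eqI)
    then show ?thesis by (intro bexI[of _ i]) auto
  qed
  have "Q n = b ` {1..n} \<and> (\<forall>i\<in>{1..n}. box_col N Q n (\<pi> i) = b i) \<longleftrightarrow> labelled_row N Q n = L"
    if Q: "Q \<in> mlqs n N" for Q
  proof
    have len': "length (labelled_row N Q n) = n"
      using labelled_row_props[OF Q, of n] by simp
    assume *: "Q n = b ` {1..n} \<and> (\<forall>i\<in>{1..n}. box_col N Q n (\<pi> i) = b i)"
    show "labelled_row N Q n = L"
    proof (rule nth_equalityI)
      fix l assume "l < length (labelled_row N Q n)"
      then obtain i where "i \<in> {1..n}" "l = \<pi> i - 1" using surj unfolding len' by blast
      then show "labelled_row N Q n ! l = L ! l"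
        using * L by (simp add: box_col_def)
    qed (simp add: len len')
  next
    assume eq: "labelled_row N Q n = L"
    have "set L = b ` {1..n}"
    proof (intro equalityI subsetI)
      fix x assume "x \<in> set L"
      then obtain l where "l < n" "x = L ! l" using len by (auto simp: in_set_conv_nth)
      with surj obtain i where "i \<in> {1..n}" "l = \<pi> i - 1" by blast
      then show "x \<in> b ` {1..n}" using L \<open>x = L ! l\<close> by blast
    next
      fix x assume "x \<in> b ` {1..n}"
      then obtain i where "i \<in> {1..n}" "x = L ! (\<pi> i - 1)" using L by auto
      moreover have "\<pi> i - 1 < n" using pi_mem[OF \<open>i \<in> {1..n}\<close>] by auto
      ultimately show "x \<in> set L" using len by simp
    qed
    then show "Q n = b ` {1..n} \<and> (\<forall>i\<in>{1..n}. box_col N Q n (\<pi> i) = b i)"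
      using labelled_row_props[OF Q, of n] eq n L by (auto simp: box_col_def)
  qed
  then show ?thesis
    unfolding G_def mlq_count_def by (intro arg_cong[where f = card]) auto
qed

lemma bij_betw_w0: "bij_betw (w0 n) {1..n} {1..n}"
  by (rule bij_betwI[where g = "w0 n"]) (auto simp: w0_def)

lemma G_w0: "n > 0 \<Longrightarrow> G n (w0 n) b N = mlq_count N n (w0_row n (\<lambda>i. b (Suc i)))"
  by (rule G_eq_mlq_count[OF bij_betw_w0]) (auto simp: w0_def)

lemma G_skw0:
  assumes "Suc p < n"
  shows "G n (skw0 n (Suc p)) b N = mlq_count N n (swap_row n p (\<lambda>i. b (Suc i)))"
proof (rule G_eq_mlq_count)
  have "bij_betw (Transposition.transpose (Suc p) (Suc p + 1)) {1..n} {1..n}"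
    using assms by (intro bij_betw_imageI) (auto simp: transpose_image_eq)
  then show "bij_betw (skw0 n (Suc p)) {1..n} {1..n}"
    unfolding skw0_def by (rule bij_betw_trans[OF bij_betw_w0])
  fix i assume i: "i \<in> {1..n}"
  \<comment> \<open>Labels start at 1 and list indices at 0, so the transposition of
    \<open>Suc p\<close> and \<open>Suc p + 1\<close> becomes that of \<open>p\<close> and
    \<open>Suc p\<close>, applied to \<open>w0 n i - 1 = n - i\<close>.\<close>
  have "skw0 n (Suc p) i - 1 = Transposition.transpose p (Suc p) (n - i)"
    using i by (auto simp: skw0_def w0_def Transposition.transpose_def)
  moreover have "Transposition.transpose p (Suc p) (n - i) < n"
    using i assms by (intro transpose_lt) auto
  ultimately show "swap_row n p (\<lambda>i. b (Suc i)) ! (skw0 n (Suc p) i - 1) = b i"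
    using i by simp
qed (use assms in auto)

theorem theoremT:
  fixes k n N :: nat and b :: "nat \<Rightarrow> nat"
  assumes "k \<in> {1, 2}"
    and "k < n" and "n \<le> N"
    and "\<And>i j. 1 \<le> i \<Longrightarrow> i < j \<Longrightarrow> j \<le> n \<Longrightarrow> b i < b j"
    and "b n \<le> N - 1"
  shows "(of_nat (G n (skw0 n k) b N) :: rat) =
           of_nat (N choose k) * det (A_mat n k b) - of_nat (G n (w0 n) b N) \<and>
         (of_nat (G n (w0 n) b N) :: rat) =
           (\<Prod>(k', l) \<in> {(k', l). 1 \<le> k' \<and> k' < l \<and> l \<le> n}. of_nat (b l) - of_nat (b k')) *
           (\<Prod>d = 1..n - 1. 1 / fact d)"
proof -
  define p where "p = k - 1"
  have k: "k = Suc p" "p \<in> {0, 1}" and p_lt: "Suc p < n" and n: "n > 0"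
    using assms(1,2) by (auto simp: p_def)
  let ?b = "\<lambda>i. b (Suc i)"
  have mono: "strict_mono_on {..<n} ?b"
    using assms(4) by (intro strict_mono_onI) auto
  have range: "?b ` {..<n} \<subseteq> {0..<N}"
  proof
    fix x assume "x \<in> ?b ` {..<n}"
    then obtain i where "i < n" "x = b (Suc i)" by blast
    moreover from this have "b (Suc i) \<le> b n"
      using assms(4)[of "Suc i" n] by (cases "Suc i = n") auto
    \<comment> \<open>The truncated bound \<open>N - 1\<close> is a strict bound by \<open>N\<close>
      only because \<open>N\<close> is positive, which follows from \<open>k < n\<close> and
      \<open>n \<le> N\<close>.\<close>
    ultimately show "x \<in> {0..<N}"
      using assms(2,3,5) by auto
  qed
  have "A_mat n k b = mat n n (\<lambda>(i, j). binom_row (n - k) i (?b i) j)"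
    unfolding A_mat_def by (rule eq_matI) (auto simp: A_entry_def binom_row_def)
  then have A: "det (A_mat n k b) = binom_det n (n - Suc p) ?b"
    by (simp add: binom_det_def k)
  have "of_nat (G n (w0 n) b N + G n (skw0 n k) b N) = of_nat (N choose k) * det (A_mat n k b)"
    using mlq_count_w0_swap_eq_det[OF k(2) p_lt mono range] G_w0[OF n] G_skw0[OF p_lt] A k(1)
    by simp
  moreover have "(of_nat (G n (w0 n) b N) :: rat) =
      (\<Prod>(k', l) \<in> {(k', l). 1 \<le> k' \<and> k' < l \<and> l \<le> n}. of_nat (b l) - of_nat (b k')) *
      (\<Prod>d = 1..n - 1. 1 / fact d)"
  proof -
    have "(\<Prod>l<n. \<Prod>k<l. of_nat (?b l) - of_nat (?b k) :: rat) =
        (\<Prod>(l, k)\<in>(SIGMA l:{..<n}. {..<l}). of_nat (?b l) - of_nat (?b k))"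
      by (rule prod.Sigma) auto
    also have "\<dots> =
        (\<Prod>(k', l) \<in> {(k', l). 1 \<le> k' \<and> k' < l \<and> l \<le> n}. of_nat (b l) - of_nat (b k'))"
      by (rule prod.reindex_bij_witness[where i = "\<lambda>(k', l). (l - 1, k' - 1)"
            and j = "\<lambda>(l, k). (Suc k, Suc l)"]) auto
    finally have "(\<Prod>l<n. \<Prod>k<l. of_nat (?b l) - of_nat (?b k) :: rat) = \<dots>" .
    moreover have "(\<Prod>j<n. 1 / fact j :: rat) = (\<Prod>d = 1..n - 1. 1 / fact d)"
    proof (rule prod.mono_neutral_right)
      show "\<forall>j\<in>{..<n} - {1..n - 1}. 1 / fact j = (1 :: rat)"
      proof
        fix j assume "j \<in> {..<n} - {1..n - 1}"
        then have "j = 0" by auto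
        then show "1 / fact j = (1 :: rat)" by simp
      qed
    qed (use n in auto)
    ultimately show ?thesis
      using mlq_count_w0_row_eq_det[OF mono range] binom_det_vandermonde[of n ?b] G_w0[OF n] by simp
  qed
  ultimately show ?thesis by simp
qed

end
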